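(* Let $\phi\in\mathcal{A}_1$ and let $\sigma\in L^\infty((0,\infty)\times\mathbb{R}^d)$ be non-negative and thin. Then the operator on $L^2(\mathbb{R}^d)$ $$T_\sigma f=\int_{(0,\infty)\times\mathbb{R}^d}\sigma(a,b)\,W_\phi f(a,b)\,\phi_{a,b}\,\frac{da}{a}\,db$$ is compact.
   Context: For $\phi\in L^2(\mathbb{R}^d)$, $a\in(0,\infty)$, $b\in\mathbb{R}^d$, put $\phi_{a,b}(x)=a^{-d/2}\phi(a^{-1}x-b)$ and $W_\phi f(a,b)=\langle f,\phi_{a,b}\rangle_{L^2(\mathbb{R}^d)}$. The index set is the group $(0,\infty)\times\mathbb{R}^d$ with operation $(a_1,b_1)(a_2,b_2)=(a_1a_2,\,a_2^{-1}b_1+b_2)$ and left Haar measure $d\lambda(a,b)=a^{-1}\,da\,db$. The integral defining $T_\sigma$ is understood weakly. With $\hat\phi$ the unitarily normalized Fourier transform, $\mathcal{A}$ is the set of admissible $\phi\in L^2(\mathbb{R}^d)$, i.e. those with $\int_0^\infty\frac{|\hat\phi(x\xi)|^2}{\xi}\,d\xi=1$ for a.e. $x\in\mathbb{R}^d$. For a weight $w$ on the group, $\mathcal{B}^1_w=\{\phi\in L^2(\mathbb{R}^d):W_\phi\phi\in L^1(w\,d\lambda)\}$. For $\varepsilon>0$ let $w_\varepsilon(a,b)=a^{d/2+\varepsilon}$, and set $\mathcal{A}_1=\left(\bigcup_{0<\varepsilon<1}\mathcal{B}^1_{w_\varepsilon}\right)\cap\mathcal{A}$. Fix a proper (balls are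 precompact) left-invariant metric on the group inducing its topology; $(a',b')\to\infty$ means that the distance from $(a',b')$ to $(1,0)$ tends to infinity. A function $\sigma$ is thin if $\int\sigma(a,b)\,|\langle\phi_{a,b},\phi_{a',b'}\rangle|^2\,d\lambda(a,b)\to0$ as $(a',b')\to\infty$. *)

theory Defs
  imports "HOL-Analysis.Analysis"
begin

section \<open>The Hilbert space of complex square-integrable functions\<close>

definition square_integrable :: "('a::euclidean_space \<Rightarrow> complex) \<Rightarrow> bool" where
  "square_integrable f \<longleftrightarrow>
     f \<in> borel_measurable lborel \<and> integrable lborel (\<lambda>x. (norm (f x))\<^sup>2)"

text \<open>Every Lebesgue-measurable function agrees almost everywhere with a Borel one, so Borel
  representatives suffice for the space of classes.\<close>

definition L2_eq :: "('a::euclidean_space \<Rightarrow> complex) \<Rightarrow> ('a \<Rightarrow> complex) \<Rightarrow> bool" where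
  "L2_eq f g \<longleftrightarrow> square_integrable f \<and> square_integrable g \<and> (AE x in lborel. f x = g x)"

lemma borel_measurable_cnj [measurable]:
  "f \<in> borel_measurable M \<Longrightarrow> (\<lambda>x. cnj (f x)) \<in> borel_measurable M"
  by (rule borel_measurable_continuous_on [OF continuous_on_cnj [OF continuous_on_id]])

lemma square_integrable_0: "square_integrable (\<lambda>_. 0)"
  by (simp add: square_integrable_def)

lemma square_integrable_cmult:
  assumes "square_integrable f" shows "square_integrable (\<lambda>x. c * f x)"
  using assms by (auto simp: square_integrable_def norm_mult power_mult_distrib)

lemma square_integrable_add:
  assumes "square_integrable f" "square_integrable g"
  shows "square_integrable (\<lambda>x. f x + g x)"
proof -
  have [measurable]: "f \<in> borel_measurable lborel" "g \<in> borel_measurable lborel"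
    using assms by (auto simp: square_integrable_def)
  have le: "(norm (u + v))\<^sup>2 \<le> 2 * (norm u)\<^sup>2 + 2 * (norm v)\<^sup>2" for u v :: complex
  proof -
    have "(norm (u + v))\<^sup>2 \<le> (norm u + norm v)\<^sup>2"
      by (intro power_mono norm_triangle_ineq) auto
    also have "\<dots> \<le> 2 * (norm u)\<^sup>2 + 2 * (norm v)\<^sup>2"
      using zero_le_power2[of "norm u - norm v"] by (simp add: power2_eq_square algebra_simps)
    finally show ?thesis .
  qed
  have "integrable lborel (\<lambda>x. (norm (f x + g x))\<^sup>2)"
    by (rule Bochner_Integration.integrable_bound
          [where f = "\<lambda>x. 2 * (norm (f x))\<^sup>2 + 2 * (norm (g x))\<^sup>2"])
       (use assms le in \<open>auto simp: square_integrable_def\<close>)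
  then show ?thesis by (simp add: square_integrable_def)
qed

lemma square_integrable_mult_cnj:
  assumes "square_integrable f" "square_integrable g"
  shows "integrable lborel (\<lambda>x. f x * cnj (g x))"
proof -
  have [measurable]: "f \<in> borel_measurable lborel" "g \<in> borel_measurable lborel"
    using assms by (auto simp: square_integrable_def)
  have le: "norm u * norm v \<le> (norm u)\<^sup>2 + (norm v)\<^sup>2" for u v :: complex
  proof -
    have "2 * (norm u * norm v) \<le> (norm u)\<^sup>2 + (norm v)\<^sup>2"
      using zero_le_power2[of "norm u - norm v"] by (simp add: power2_eq_square algebra_simps)
    moreover have "0 \<le> norm u * norm v" by simp
    ultimately show ?thesis by linarith
  qed
  show ?thesis
    by (rule Bochner_Integration.integrable_bound
          [where f = "\<lambda>x. (norm (f x))\<^sup>2 + (norm (g x))\<^sup>2"])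
       (use assms le in \<open>auto simp: square_integrable_def norm_mult\<close>)
qed

quotient_type (overloaded) 'a L2 = "'a::euclidean_space \<Rightarrow> complex" / partial: L2_eq
proof (rule part_equivpI)
  show "\<exists>f::'a \<Rightarrow> complex. L2_eq f f"
    using square_integrable_0 by (auto simp: L2_eq_def)
  show "symp (L2_eq :: ('a \<Rightarrow> complex) \<Rightarrow> _)"
    by (auto simp: symp_def L2_eq_def)
  show "transp (L2_eq :: ('a \<Rightarrow> complex) \<Rightarrow> _)"
    by (auto simp: transp_def L2_eq_def)
qed

lemma square_integrable_rep_L2: "square_integrable (rep_L2 f)"
  using Quotient3_rep_reflp[OF Quotient3_L2, of f] by (simp add: L2_eq_def)

text \<open>The inner product is linear in the first argument, antilinear in the second.\<close>

lift_definition cinner :: "'a::euclidean_space L2 \<Rightarrow> 'a L2 \<Rightarrow> complex"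
  is "\<lambda>f g. LINT x|lborel. f x * cnj (g x)"
  by (intro integral_cong_AE) (auto simp: L2_eq_def square_integrable_def intro!: borel_measurable_times borel_measurable_cnj)

lift_definition scaleC :: "complex \<Rightarrow> 'a::euclidean_space L2 \<Rightarrow> 'a L2"
  is "\<lambda>c f x. c * f x"
  by (auto simp: L2_eq_def square_integrable_cmult)

instantiation L2 :: (euclidean_space) real_vector
begin

lift_definition zero_L2 :: "'a L2" is "\<lambda>_. 0"
  by (simp add: L2_eq_def square_integrable_0)

lift_definition plus_L2 :: "'a L2 \<Rightarrow> 'a L2 \<Rightarrow> 'a L2" is "\<lambda>f g x. f x + g x"
  by (auto simp: L2_eq_def square_integrable_add)

definition scaleR_L2 :: "real \<Rightarrow> 'a L2 \<Rightarrow> 'a L2" where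
  "scaleR_L2 r f = scaleC (complex_of_real r) f"

definition uminus_L2 :: "'a L2 \<Rightarrow> 'a L2" where
  "uminus_L2 f = scaleC (- 1) f"

definition minus_L2 :: "'a L2 \<Rightarrow> 'a L2 \<Rightarrow> 'a L2" where
  "minus_L2 f g = f + (- g)"

instance
proof
  fix f g h :: "'a L2" and r s :: real
  show "f + g + h = f + (g + h)"
    by transfer (auto simp: L2_eq_def add.assoc intro!: square_integrable_add)
  show "f + g = g + f"
    by transfer (auto simp: L2_eq_def add.commute intro!: square_integrable_add)
  show "0 + f = f"
    by transfer (auto simp: L2_eq_def)
  show "- f + f = 0"
    unfolding uminus_L2_def
    by transfer (auto simp: L2_eq_def square_integrable_0)
  show "f - g = f + - g"
    by (rule minus_L2_def)
  show "r *\<^sub>R (f + g) = r *\<^sub>R f + r *\<^sub>R g"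
    unfolding scaleR_L2_def
    by transfer (auto simp: L2_eq_def distrib_left
        intro!: square_integrable_add square_integrable_cmult)
  show "(r + s) *\<^sub>R f = r *\<^sub>R f + s *\<^sub>R f"
    unfolding scaleR_L2_def
    by transfer (auto simp: L2_eq_def distrib_right
        intro!: square_integrable_add square_integrable_cmult)
  show "r *\<^sub>R s *\<^sub>R f = (r * s) *\<^sub>R f"
    unfolding scaleR_L2_def
    by transfer (auto simp: L2_eq_def mult.assoc intro!: square_integrable_cmult)
  show "1 *\<^sub>R f = f"
    unfolding scaleR_L2_def by transfer (auto simp: L2_eq_def)
qed

end

instantiation L2 :: (euclidean_space) real_inner
begin

definition inner_L2 :: "'a L2 \<Rightarrow> 'a L2 \<Rightarrow> real" where
  "inner_L2 f g = Re (cinner f g)"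

definition norm_L2 :: "'a L2 \<Rightarrow> real" where
  "norm_L2 f = sqrt (inner f f)"

definition sgn_L2 :: "'a L2 \<Rightarrow> 'a L2" where
  "sgn_L2 f = f /\<^sub>R norm f"

definition dist_L2 :: "'a L2 \<Rightarrow> 'a L2 \<Rightarrow> real" where
  "dist_L2 f g = norm (f - g)"

definition uniformity_L2 :: "('a L2 \<times> 'a L2) filter" where
  "uniformity_L2 = (INF e\<in>{0<..}. principal {(x, y). dist x y < e})"

definition open_L2 :: "'a L2 set \<Rightarrow> bool" where
  "open_L2 U = (\<forall>x\<in>U. \<forall>\<^sub>F (x', y) in uniformity. x' = x \<longrightarrow> y \<in> U)"

instance
proof
  fix f g h :: "'a L2" and r :: real
  show "sgn f = f /\<^sub>R norm f"
    by (rule sgn_L2_def)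
  show "dist f g = norm (f - g)"
    by (rule dist_L2_def)
  show "uniformity = (INF e\<in>{0<..}. principal {(x, y :: 'a L2). dist x y < e})"
    by (rule uniformity_L2_def)
  show "open U = (\<forall>x\<in>U. \<forall>\<^sub>F (x', y) in uniformity. x' = x \<longrightarrow> y \<in> U)" for U :: "'a L2 set"
    by (rule open_L2_def)
  show "inner f g = inner g f"
    unfolding inner_L2_def
  proof transfer
    fix f g :: "'a \<Rightarrow> complex"
    have "(LINT x|lborel. f x * cnj (g x)) = (LINT x|lborel. cnj (g x * cnj (f x)))"
      by (simp add: mult.commute)
    also have "\<dots> = cnj (LINT x|lborel. g x * cnj (f x))"
      by (rule Bochner_Integration.integral_cnj)
    finally show "Re (LINT x|lborel. f x * cnj (g x)) = Re (LINT x|lborel. g x * cnj (f x))"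
      by simp
  qed
  show "inner (f + g) h = inner f h + inner g h"
    unfolding inner_L2_def
    by transfer (auto simp: L2_eq_def distrib_right square_integrable_mult_cnj)
  show "inner (r *\<^sub>R f) g = r * inner f g"
    unfolding inner_L2_def scaleR_L2_def
    by transfer (simp add: mult.assoc)
  have sq: "(LINT x|lborel. F x * cnj (F x)) = complex_of_real (LINT x|lborel. (norm (F x))\<^sup>2)"
    for F :: "'a \<Rightarrow> complex"
    by (simp only: complex_norm_square [symmetric] integral_complex_of_real)
  show "0 \<le> inner f f"
    unfolding inner_L2_def by transfer (simp add: sq)
  show "inner f f = 0 \<longleftrightarrow> f = 0"
    unfolding inner_L2_def
  proof transfer
    fix f :: "'a \<Rightarrow> complex"
    assume "L2_eq f f"
    then have f: "square_integrable f" by (simp add: L2_eq_def)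
    then have "(LINT x|lborel. (norm (f x))\<^sup>2) = 0 \<longleftrightarrow> (AE x in lborel. (norm (f x))\<^sup>2 = 0)"
      by (intro integral_nonneg_eq_0_iff_AE) (auto simp: square_integrable_def)
    then show "Re (LINT x|lborel. f x * cnj (f x)) = 0 \<longleftrightarrow> L2_eq f (\<lambda>_. 0)"
      using f by (simp add: sq L2_eq_def square_integrable_0)
  qed
  show "norm f = sqrt (inner f f)"
    by (rule norm_L2_def)
qed

end

definition compact_operator :: "('a::euclidean_space L2 \<Rightarrow> 'a L2) \<Rightarrow> bool" where
  "compact_operator T \<longleftrightarrow>
     bounded_linear T \<and> (\<forall>c f. T (scaleC c f) = scaleC c (T f)) \<and>
     compact (closure (T ` cball 0 1))"


section \<open>The Fourier transform\<close>

text \<open>There are two unitary normalizations in common use. This is the one for which the constant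
  1 in the admissibility condition below makes the wavelet transform an isometry. The other one
  rescales admissible functions by a constant.\<close>

definition fourier_integral :: "('a::euclidean_space \<Rightarrow> complex) \<Rightarrow> 'a \<Rightarrow> complex" where
  "fourier_integral f \<xi> = (LINT x|lborel. f x * exp (- 2 * of_real pi * \<i> * of_real (x \<bullet> \<xi>)))"

text \<open>The transform of a square-integrable function is the limit in the mean of the integrals over
  balls of increasing radius.\<close>

definition has_fourier_transform :: "'a::euclidean_space L2 \<Rightarrow> 'a L2 \<Rightarrow> bool" where
  "has_fourier_transform f g \<longleftrightarrow>
     ((\<lambda>R::real. \<integral>\<^sup>+\<xi>. ennreal
         ((norm (fourier_integral (\<lambda>x. indicator (cball 0 R) x * rep_L2 f x) \<xi> - rep_L2 g \<xi>))\<^sup>2)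
         \<partial>lborel) \<longlongrightarrow> 0) at_top"


section \<open>The index group\<close>

definition affine_group :: "(real \<times> 'a::euclidean_space) set" where
  "affine_group = {0<..} \<times> UNIV"

definition affine_mult ::
    "real \<times> 'a::euclidean_space \<Rightarrow> real \<times> 'a \<Rightarrow> real \<times> 'a" where
  "affine_mult p q = (fst p * fst q, snd p /\<^sub>R fst q + snd q)"

definition affine_haar :: "(real \<times> 'a::euclidean_space) measure" where
  "affine_haar = density (restrict_space lborel affine_group) (\<lambda>p. ennreal (1 / fst p))"

text \<open>The locale for metric spaces also demands nonnegativity and symmetry off the carrier; every
  metric on the group extends that way.\<close>

definition proper_left_invariant_metric ::
    "(real \<times> 'a::euclidean_space \<Rightarrow> real \<times> 'a \<Rightarrow> real) \<Rightarrow> bool" where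
  "proper_left_invariant_metric D \<longleftrightarrow>
     Metric_space affine_group D \<and>
     Metric_space.mtopology affine_group D = top_of_set affine_group \<and>
     (\<forall>p\<in>affine_group. \<forall>r.
        compactin (Metric_space.mtopology affine_group D)
          (Metric_space.mtopology affine_group D closure_of Metric_space.mball affine_group D p r)) \<and>
     (\<forall>p\<in>affine_group. \<forall>q\<in>affine_group. \<forall>q'\<in>affine_group.
        D (affine_mult p q) (affine_mult p q') = D q q')"

definition at_infinity_wrt ::
    "(real \<times> 'a::euclidean_space \<Rightarrow> real \<times> 'a \<Rightarrow> real) \<Rightarrow> (real \<times> 'a) filter" where
  "at_infinity_wrt D = inf (filtercomap (\<lambda>p. D p (1, 0)) at_top) (principal affine_group)"

definition Linfty :: "(real \<times> 'a::euclidean_space \<Rightarrow> real) set" where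
  "Linfty = {\<sigma>. \<sigma> \<in> borel_measurable affine_haar \<and> (\<exists>C. AE p in affine_haar. \<bar>\<sigma> p\<bar> \<le> C)}"


section \<open>Wavelets\<close>

lemma
  fixes f g :: "'a::euclidean_space \<Rightarrow> complex" and a :: real
  assumes a: "a \<noteq> 0"
  shows AE_lborel_dilate:
      "(AE x in lborel. f x = g x) \<Longrightarrow> f \<in> borel_measurable lborel \<Longrightarrow> g \<in> borel_measurable lborel
        \<Longrightarrow> AE x in lborel. f (x /\<^sub>R a - b) = g (x /\<^sub>R a - b)"
    and square_integrable_dilate:
      "square_integrable f \<Longrightarrow> square_integrable (\<lambda>x. f (x /\<^sub>R a - b))"
proof -
  define S where "S = (\<lambda>x::'a. - b + inverse a *\<^sub>R x)"
  have S: "x /\<^sub>R a - b = S x" for x by (simp add: S_def)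
  have S_meas [measurable]: "S \<in> borel_measurable borel" by (simp add: S_def)
  define k where "k = \<bar>inverse a\<bar> ^ DIM('a)"
  have k: "k > 0" using a by (simp add: k_def)
  have eq: "lborel = density (distr lborel borel S) (\<lambda>_. ennreal k)"
    using lborel_affine[of "inverse a" "- b"] a by (simp add: S_def k_def)
  {
    assume ae: "AE x in lborel. f x = g x"
      and [measurable]: "f \<in> borel_measurable lborel" "g \<in> borel_measurable lborel"
    have "AE x in density (distr lborel borel S) (\<lambda>_. ennreal k). f x = g x"
      using ae by (subst eq [symmetric])
    then have "AE x in distr lborel borel S. f x = g x"
      using k by (simp add: AE_density)
    then show "AE x in lborel. f (x /\<^sub>R a - b) = g (x /\<^sub>R a - b)"
      by (subst (asm) AE_distr_iff) (auto simp: S)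
  next
    assume f: "square_integrable f"
    then have [measurable]: "f \<in> borel_measurable borel" by (simp add: square_integrable_def)
    have "integrable (density (distr lborel borel S) (\<lambda>_. ennreal k)) (\<lambda>x. (norm (f x))\<^sup>2)"
      using f by (subst eq [symmetric]) (simp add: square_integrable_def)
    then have "integrable (distr lborel borel S) (\<lambda>x. (norm (f x))\<^sup>2)"
      using k by (subst (asm) integrable_density) auto
    then have "integrable lborel (\<lambda>x. (norm (f (S x)))\<^sup>2)"
      by (subst (asm) integrable_distr_eq) auto
    then show "square_integrable (\<lambda>x. f (x /\<^sub>R a - b))"
      by (simp add: square_integrable_def S)
  }
qed

text \<open>Only positive scales matter; the formula also makes sense for the other ones.\<close>

lift_definition wavelet :: "'a::euclidean_space L2 \<Rightarrow> real \<times> 'a \<Rightarrow> 'a L2"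
  is "\<lambda>\<phi> (a, b) x. complex_of_real (a powr (- real DIM('a) / 2)) * \<phi> (x /\<^sub>R a - b)"
proof -
  fix f g :: "'a \<Rightarrow> complex" and p :: "real \<times> 'a"
  assume fg: "L2_eq f g"
  obtain a b where p: "p = (a, b)" by (cases p)
  show "L2_eq (case p of (a, b) \<Rightarrow>
            \<lambda>x. complex_of_real (a powr (- real DIM('a) / 2)) * f (x /\<^sub>R a - b))
          (case p of (a, b) \<Rightarrow>
            \<lambda>x. complex_of_real (a powr (- real DIM('a) / 2)) * g (x /\<^sub>R a - b))"
  proof (cases "a = 0")
    case True
    then show ?thesis by (simp add: p L2_eq_def square_integrable_0)
  next
    case False
    have "AE x in lborel. f (x /\<^sub>R a - b) = g (x /\<^sub>R a - b)"
      using fg by (intro AE_lborel_dilate[OF False]) (auto simp: L2_eq_def square_integrable_def)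
    then show ?thesis
      using fg
      by (auto simp: p L2_eq_def
          intro!: square_integrable_cmult square_integrable_dilate[OF False])
  qed
qed

definition wavelet_transform ::
    "'a::euclidean_space L2 \<Rightarrow> 'a L2 \<Rightarrow> real \<times> 'a \<Rightarrow> complex" where
  "wavelet_transform \<phi> f p = cinner f (wavelet \<phi> p)"

definition admissible :: "'a::euclidean_space L2 set" where
  "admissible = {\<phi>. \<exists>g. has_fourier_transform \<phi> g \<and>
     (AE x in lborel.
        (\<integral>\<^sup>+\<xi>\<in>{0<..}. ennreal ((norm (rep_L2 g (\<xi> *\<^sub>R x)))\<^sup>2 / \<xi>) \<partial>lborel) = 1)}"

definition B1 :: "(real \<times> 'a::euclidean_space \<Rightarrow> real) \<Rightarrow> 'a L2 set" where
  "B1 w = {\<phi>. integrable (density affine_haar (\<lambda>p. ennreal (w p))) (wavelet_transform \<phi> \<phi>)}"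

definition scale_weight :: "real \<Rightarrow> real \<times> 'a::euclidean_space \<Rightarrow> real" where
  "scale_weight \<epsilon> p = fst p powr (real DIM('a) / 2 + \<epsilon>)"

definition A1 :: "'a::euclidean_space L2 set" where
  "A1 = (\<Union>\<epsilon>\<in>{0<..<1}. B1 (scale_weight \<epsilon>)) \<inter> admissible"

text \<open>The integral is that of a nonnegative function only for a nonnegative symbol, the only case
  in which the notion is used.\<close>

definition thin ::
    "(real \<times> 'a::euclidean_space \<Rightarrow> real \<times> 'a \<Rightarrow> real) \<Rightarrow> 'a L2 \<Rightarrow>
     (real \<times> 'a \<Rightarrow> real) \<Rightarrow> bool" where
  "thin D \<phi> \<sigma> \<longleftrightarrow>
     ((\<lambda>p'. \<integral>\<^sup>+p. ennreal (\<sigma> p * (norm (cinner (wavelet \<phi> p) (wavelet \<phi> p')))\<^sup>2) \<partial>affine_haar)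
        \<longlongrightarrow> 0) (at_infinity_wrt D)"

text \<open>The weak integral: the vector whose inner product with every \<open>g\<close> is the integral of the
  inner products of the integrand with \<open>g\<close>.\<close>

definition localization_operator ::
    "'a::euclidean_space L2 \<Rightarrow> (real \<times> 'a \<Rightarrow> real) \<Rightarrow> 'a L2 \<Rightarrow> 'a L2" where
  "localization_operator \<phi> \<sigma> f = (THE h. \<forall>g.
     has_bochner_integral affine_haar
       (\<lambda>p. cinner (scaleC (complex_of_real (\<sigma> p) * wavelet_transform \<phi> f p) (wavelet \<phi> p)) g)
       (cinner h g))"

end

theory Submission
  imports Defs
begin

text \<open>Write \<open>W f p = \<langle>f, \<phi>\<^sub>p\<rangle>\<close>. The kernel \<open>\<langle>\<phi>\<^sub>p, \<phi>\<^sub>q\<rangle>\<close> depends only on \<open>p\<inverse>q\<close>, and the weight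
  \<open>w\<close> is multiplicative, so by left invariance \<open>W \<phi> \<in> L\<^sup>1(w d\<lambda>)\<close> is the hypothesis of Schur's test with
  weight \<open>w\<close>. Hence \<open>W\<close> is bounded and all localization operators \<open>T\<^sub>\<tau> = W\<^sup>* \<tau> W\<close> with bounded \<open>\<tau>\<close>
  exist. For a thin \<open>\<sigma>\<close> the weighted row integrals of \<open>\<sigma>(q) \<bar>\<langle>\<phi>\<^sub>p, \<phi>\<^sub>q\<rangle>\<bar>\<close> become small outside a
  compact set \<open>K\<close> of points \<open>p\<close>, so by Schur's test \<open>T\<^sub>\<sigma> T\<^sub>1\<close> is a norm limit of operators \<open>T\<^sub>\<sigma> T\<^sub>K\<close>,
  where \<open>T\<^sub>K\<close>, the operator of the indicator of \<open>K\<close>, is compact because it is positive of finite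
  trace. Instead of the reproducing formula \<open>T\<^sub>1 = 1\<close>, which rests on Plancherel's theorem, the
  Landweber iteration \<open>R = 1 - T\<^sub>1 / C\<close> is used: \<open>T\<^sub>\<sigma> (1 - R\<^sup>n)\<close> is \<open>T\<^sub>\<sigma> T\<^sub>1\<close> times a polynomial in \<open>T\<^sub>1\<close>,
  and \<open>\<parallel>W R\<^sup>n\<parallel>\<close> tends to \<open>0\<close> even if \<open>T\<^sub>1\<close> is not invertible.\<close>

section \<open>Compact operators on Hilbert spaces\<close>

lemma minimizing_sequence_Cauchy:
  fixes X :: "nat \<Rightarrow> 'h::real_inner" and l :: "'h \<Rightarrow> real"
  assumes l: "linear l"
    and m: "\<And>g. m \<le> (norm g)\<^sup>2 / 2 - l g"
    and X: "\<And>n. (norm (X n))\<^sup>2 / 2 - l (X n) < m + 1 / Suc n"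
  shows "Cauchy X"
proof -
  define J where "J g = (norm g)\<^sup>2 / 2 - l g" for g
  \<comment> \<open>The parallelogram identity for \<open>J\<close>: the midpoint of two almost
    minimal points has value at least \<open>m\<close>, which forces the two points to be close to
    each other.\<close>
  have par: "(norm (x - y))\<^sup>2 / 4 = J x + J y - 2 * J ((x + y) /\<^sub>R 2)" for x y
    unfolding J_def power2_norm_eq_inner
    by (simp add: linear_add[OF l] linear_scale[OF l] inner_simps inner_commute field_simps)
  have est: "(norm (X i - X j))\<^sup>2 < 8 / Suc n" if "i \<ge> n" "j \<ge> n" for i j n
  proof -
    have "(norm (X i - X j))\<^sup>2 / 4 < 1 / Suc i + 1 / Suc j"
      using par[of "X i" "X j"] X[of i, folded J_def] X[of j, folded J_def]
        m[of "(X i + X j) /\<^sub>R 2", folded J_def] by linarith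
    also have "\<dots> \<le> 1 / Suc n + 1 / Suc n"
      using that by (intro add_mono divide_left_mono) auto
    finally show ?thesis by simp
  qed
  show ?thesis
  proof (rule metric_CauchyI)
    fix e :: real assume e: "e > 0"
    obtain n where n: "8 / e\<^sup>2 < real n" using reals_Archimedean2 by blast
    show "\<exists>M. \<forall>i\<ge>M. \<forall>j\<ge>M. dist (X i) (X j) < e"
    proof (intro exI[of _ n] allI impI)
      fix i j assume "n \<le> i" "n \<le> j"
      then have "(norm (X i - X j))\<^sup>2 < 8 / Suc n" by (rule est)
      also have "\<dots> < e\<^sup>2" using n e by (simp add: field_simps add_strict_increasing)
      finally show "dist (X i) (X j) < e"
        using e by (simp add: dist_norm power_less_imp_less_base)
    qed
  qed
qed

text \<open>Up to an additive constant, \<open>J g\<close> is half the squared distance from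
  \<open>g\<close> to the vector sought, so that vector is found as the minimizer of
  \<open>J\<close>. Completeness enters through the limit of a minimizing sequence.\<close>

theorem riesz_representation:
  fixes l :: "'h::{real_inner,complete_space} \<Rightarrow> real"
  assumes "bounded_linear l"
  obtains h where "\<And>g. l g = inner h g"
proof -
  interpret bounded_linear l by fact
  define J where "J g = (norm g)\<^sup>2 / 2 - l g" for g
  obtain K where K: "\<And>g. norm (l g) \<le> norm g * K" using bounded by blast
  have bdd: "bdd_below (range J)"
  proof (rule bdd_belowI2)
    fix g :: 'h
    have "0 \<le> (norm g - K)\<^sup>2" by simp
    then have "norm g * K \<le> (norm g)\<^sup>2 / 2 + K\<^sup>2 / 2"
      by (simp add: power2_diff)
    with K[of g] show "- K\<^sup>2 / 2 \<le> J g" by (simp add: J_def)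
  qed
  define m where "m = Inf (range J)"
  have m: "m \<le> J g" for g unfolding m_def by (intro cInf_lower bdd) auto
  have "\<exists>g. J g < m + 1 / Suc n" for n
  proof -
    have "Inf (range J) < m + 1 / Suc n" unfolding m_def by simp
    then show ?thesis using cInf_lessD[of "range J"] by auto
  qed
  then obtain X where X: "\<And>n. J (X n) < m + 1 / Suc n" by metis
  have "Cauchy X"
    by (rule minimizing_sequence_Cauchy[where l = l and m = m])
       (use m X in \<open>auto simp: J_def linear_axioms\<close>)
  then obtain h where h: "X \<longlonglongrightarrow> h" using Cauchy_convergent convergent_def by blast
  have "(\<lambda>n. J (X n)) \<longlonglongrightarrow> J h" unfolding J_def by (intro tendsto_intros tendsto h) simp
  moreover have "(\<lambda>n. m + 1 / Suc n) \<longlonglongrightarrow> m + 0"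
    by (intro tendsto_intros LIMSEQ_Suc[OF lim_1_over_n])
  ultimately have "J h \<le> m + 0" by (rule LIMSEQ_le) (use X less_imp_le in blast)
  then have min: "J h \<le> J g" for g using m[of g] by simp
  have "l g = inner h g" for g
  proof (rule ccontr)
    assume "l g \<noteq> inner h g"
    define d where "d = inner h g - l g"
    have d: "d \<noteq> 0" using \<open>l g \<noteq> inner h g\<close> by (simp add: d_def)
    have "g \<noteq> 0" using d zero by (auto simp: d_def)
    \<comment> \<open>The minimum of \<open>J\<close> on the line through \<open>h\<close> in
      direction \<open>g\<close> is at this \<open>t\<close>; it lies strictly below
      \<open>J h\<close> when \<open>d\<close> is nonzero.\<close>
    define t where "t = - d / (norm g)\<^sup>2"
    have "J (h + t *\<^sub>R g) = J h + t * d + t\<^sup>2 * (norm g)\<^sup>2 / 2"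
      unfolding J_def d_def power2_norm_eq_inner
      by (simp add: add scaleR inner_simps inner_commute power2_eq_square algebra_simps)
    moreover have "t * d + t\<^sup>2 * (norm g)\<^sup>2 / 2 = - d\<^sup>2 / (2 * (norm g)\<^sup>2)"
      using \<open>g \<noteq> 0\<close> by (simp add: t_def field_simps power2_eq_square)
    moreover have "- d\<^sup>2 / (2 * (norm g)\<^sup>2) < 0" using d \<open>g \<noteq> 0\<close> by simp
    ultimately show False using min[of "h + t *\<^sub>R g"] by linarith
  qed
  then show ?thesis by (rule that)
qed

text \<open>For bounded linear maps between Hilbert spaces this is compactness, expressed without
  sequences or convergence.\<close>

definition small_off_finite :: "('h::real_inner \<Rightarrow> 'k::real_normed_vector) \<Rightarrow> bool" where
  "small_off_finite T \<longleftrightarrow>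
     (\<forall>\<epsilon>>0. \<exists>E. finite E \<and> (\<forall>g. (\<forall>e\<in>E. inner g e = 0) \<longrightarrow> norm (T g) \<le> \<epsilon> * norm g))"

section \<open>Closure properties of maps that are small off a finite set\<close>

lemma small_off_finiteE:
  assumes "small_off_finite T" "\<epsilon> > 0"
  obtains E where "finite E" "\<And>g. (\<And>e. e \<in> E \<Longrightarrow> inner g e = 0) \<Longrightarrow> norm (T g) \<le> \<epsilon> * norm g"
  using assms unfolding small_off_finite_def by metis

lemma small_off_finite_add:
  assumes S: "small_off_finite S" and T: "small_off_finite T"
  shows "small_off_finite (\<lambda>g. S g + T g)"
  unfolding small_off_finite_def
proof (intro allI impI)
  fix \<epsilon> :: real assume "\<epsilon> > 0"
  then have e: "\<epsilon> / 2 > 0" by simp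
  obtain E where E: "finite E" "\<And>g. (\<And>e. e \<in> E \<Longrightarrow> inner g e = 0) \<Longrightarrow> norm (S g) \<le> \<epsilon> / 2 * norm g"
    using small_off_finiteE[OF S e] by blast
  obtain F where F: "finite F" "\<And>g. (\<And>e. e \<in> F \<Longrightarrow> inner g e = 0) \<Longrightarrow> norm (T g) \<le> \<epsilon> / 2 * norm g"
    using small_off_finiteE[OF T e] by blast
  show "\<exists>E. finite E \<and> (\<forall>g. (\<forall>e\<in>E. inner g e = 0) \<longrightarrow> norm (S g + T g) \<le> \<epsilon> * norm g)"
  proof (intro exI[of _ "E \<union> F"] conjI allI impI)
    fix g assume "\<forall>e\<in>E \<union> F. inner g e = 0"
    then have "norm (S g) \<le> \<epsilon> / 2 * norm g" "norm (T g) \<le> \<epsilon> / 2 * norm g"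
      using E(2) F(2) by auto
    then show "norm (S g + T g) \<le> \<epsilon> * norm g"
      using norm_triangle_ineq[of "S g" "T g"] by linarith
  qed (use E F in auto)
qed

lemma small_off_finite_zero: "small_off_finite (\<lambda>_. 0)"
  by (auto simp: small_off_finite_def intro!: exI[of _ "{}"])

lemma small_off_finite_sum:
  assumes "\<And>i. i \<in> I \<Longrightarrow> small_off_finite (T i)"
  shows "small_off_finite (\<lambda>g. \<Sum>i\<in>I. T i g)"
proof (cases "finite I")
  case True
  then show ?thesis using assms
    by (induction) (auto intro: small_off_finite_zero small_off_finite_add)
qed (simp add: small_off_finite_zero)

lemma small_off_finite_compose_left:
  assumes T: "small_off_finite T" and B: "\<And>x. norm (B x) \<le> K * norm x"
  shows "small_off_finite (\<lambda>g. B (T g))"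
  unfolding small_off_finite_def
proof (intro allI impI)
  fix \<epsilon> :: real assume e: "\<epsilon> > 0"
  \<comment> \<open>The bound \<open>K\<close> may vanish, so a positive substitute serves as
    divisor.\<close>
  have K': "\<bar>K\<bar> + 1 > 0" by simp
  then have "\<epsilon> / (\<bar>K\<bar> + 1) > 0" using e by simp
  then obtain E where E: "finite E"
    "\<And>g. (\<And>e. e \<in> E \<Longrightarrow> inner g e = 0) \<Longrightarrow> norm (T g) \<le> \<epsilon> / (\<bar>K\<bar> + 1) * norm g"
    using small_off_finiteE[OF T] by blast
  show "\<exists>E. finite E \<and> (\<forall>g. (\<forall>e\<in>E. inner g e = 0) \<longrightarrow> norm (B (T g)) \<le> \<epsilon> * norm g)"
  proof (intro exI[of _ E] conjI allI impI E(1))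
    fix g assume g: "\<forall>e\<in>E. inner g e = 0"
    have "norm (B (T g)) \<le> K * norm (T g)" by (rule B)
    also have "\<dots> \<le> (\<bar>K\<bar> + 1) * norm (T g)" by (intro mult_right_mono) auto
    also have "\<dots> \<le> (\<bar>K\<bar> + 1) * (\<epsilon> / (\<bar>K\<bar> + 1) * norm g)"
      using g by (intro mult_left_mono E(2)) auto
    also have "\<dots> = \<epsilon> * norm g" using K' by simp
    finally show "norm (B (T g)) \<le> \<epsilon> * norm g" .
  qed
qed

text \<open>Symmetry of \<open>B\<close> transports the orthogonality conditions: if
  \<open>g\<close> is orthogonal to the image of \<open>E\<close> under \<open>B\<close>, then
  \<open>B g\<close> is orthogonal to \<open>E\<close>. The maps inserted for \<open>B\<close> later
  are powers of the symmetric map \<open>landweber\<close>.\<close>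

lemma small_off_finite_compose_right:
  assumes T: "small_off_finite T" and B: "\<And>x. norm (B x) \<le> K * norm x"
    and sym: "\<And>x y. inner (B x) y = inner x (B y)"
  shows "small_off_finite (\<lambda>g. T (B g))"
  unfolding small_off_finite_def
proof (intro allI impI)
  fix \<epsilon> :: real assume e: "\<epsilon> > 0"
  have K': "\<bar>K\<bar> + 1 > 0" by simp
  then have e': "\<epsilon> / (\<bar>K\<bar> + 1) > 0" using e by simp
  then obtain E where E: "finite E"
    "\<And>g. (\<And>e. e \<in> E \<Longrightarrow> inner g e = 0) \<Longrightarrow> norm (T g) \<le> \<epsilon> / (\<bar>K\<bar> + 1) * norm g"
    using small_off_finiteE[OF T] by blast
  show "\<exists>E. finite E \<and> (\<forall>g. (\<forall>e\<in>E. inner g e = 0) \<longrightarrow> norm (T (B g)) \<le> \<epsilon> * norm g)"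
  proof (intro exI[of _ "B ` E"] conjI allI impI)
    fix g assume g: "\<forall>e\<in>B ` E. inner g e = 0"
    have "norm (T (B g)) \<le> \<epsilon> / (\<bar>K\<bar> + 1) * norm (B g)"
      using g by (intro E(2)) (auto simp: sym)
    also have "\<dots> \<le> \<epsilon> / (\<bar>K\<bar> + 1) * ((\<bar>K\<bar> + 1) * norm g)"
    proof (rule mult_left_mono)
      show "norm (B g) \<le> (\<bar>K\<bar> + 1) * norm g"
        by (rule order_trans[OF B]) (intro mult_right_mono, auto)
    qed (use e' in simp)
    also have "\<dots> = \<epsilon> * norm g" using K' by simp
    finally show "norm (T (B g)) \<le> \<epsilon> * norm g" .
  qed (use E in auto)
qed

lemma small_off_finite_approx:
  assumes "\<And>\<epsilon>. \<epsilon> > 0 \<Longrightarrow> \<exists>S. small_off_finite S \<and> (\<forall>g. norm (T g - S g) \<le> \<epsilon> * norm g)"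
  shows "small_off_finite T"
  unfolding small_off_finite_def
proof (intro allI impI)
  fix \<epsilon> :: real assume "\<epsilon> > 0"
  then have e: "\<epsilon> / 2 > 0" by simp
  obtain S where S: "small_off_finite S" "\<And>g. norm (T g - S g) \<le> \<epsilon> / 2 * norm g"
    using assms[OF e] by blast
  obtain E where E: "finite E" "\<And>g. (\<And>e. e \<in> E \<Longrightarrow> inner g e = 0) \<Longrightarrow> norm (S g) \<le> \<epsilon> / 2 * norm g"
    using small_off_finiteE[OF S(1) e] by blast
  show "\<exists>E. finite E \<and> (\<forall>g. (\<forall>e\<in>E. inner g e = 0) \<longrightarrow> norm (T g) \<le> \<epsilon> * norm g)"
  proof (intro exI[of _ E] conjI allI impI E(1))
    fix g assume "\<forall>e\<in>E. inner g e = 0"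
    then have "norm (S g) \<le> \<epsilon> / 2 * norm g" using E(2) by auto
    then show "norm (T g) \<le> \<epsilon> * norm g"
      using S(2)[of g] norm_triangle_ineq[of "T g - S g" "S g"] by simp
  qed
qed

section \<open>Relative compactness of the image of the unit ball\<close>

lemma compact_box_combinations:
  fixes v :: "'b \<Rightarrow> 'h::real_normed_vector"
  assumes "finite B"
  shows "compact {\<Sum>b\<in>B. c b *\<^sub>R v b |c. \<forall>b\<in>B. \<bar>c b\<bar> \<le> r b}"
  using assms
proof induction
  case empty
  then show ?case by simp
next
  case (insert b B)
  let ?A = "\<lambda>B. {\<Sum>b\<in>B. c b *\<^sub>R v b |c. \<forall>b\<in>B. \<bar>c b\<bar> \<le> r b}"
  have seg: "compact ((\<lambda>t. t *\<^sub>R v b) ` {- r b..r b})"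
    by (intro compact_continuous_image continuous_intros) auto
  \<comment> \<open>Each new vector adds a compact segment, so the set for \<open>insert b B\<close>
    is the sum of two compact sets.\<close>
  have "?A (insert b B) \<subseteq> (\<Union>x\<in>(\<lambda>t. t *\<^sub>R v b) ` {- r b..r b}. \<Union>y\<in>?A B. {x + y})"
  proof
    fix z assume "z \<in> ?A (insert b B)"
    then obtain c where c: "z = (\<Sum>b\<in>insert b B. c b *\<^sub>R v b)" "\<forall>b\<in>insert b B. \<bar>c b\<bar> \<le> r b"
      by blast
    then have "z = c b *\<^sub>R v b + (\<Sum>b\<in>B. c b *\<^sub>R v b)" using insert by simp
    with c(2) show "z \<in> (\<Union>x\<in>(\<lambda>t. t *\<^sub>R v b) ` {- r b..r b}. \<Union>y\<in>?A B. {x + y})"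
      by (auto simp: abs_le_iff intro!: bexI[of _ "c b"])
  qed
  moreover have "(\<Union>x\<in>(\<lambda>t. t *\<^sub>R v b) ` {- r b..r b}. \<Union>y\<in>?A B. {x + y}) \<subseteq> ?A (insert b B)"
  proof clarify
    fix t c assume t: "t \<in> {- r b..r b}" and c: "\<forall>b\<in>B. \<bar>c b\<bar> \<le> r b"
    have "t *\<^sub>R v b + (\<Sum>b\<in>B. c b *\<^sub>R v b) = (\<Sum>i\<in>insert b B. (c(b := t)) i *\<^sub>R v i)"
      using insert by (auto intro!: sum.cong)
    then show "\<exists>d. t *\<^sub>R v b + (\<Sum>b\<in>B. c b *\<^sub>R v b) = (\<Sum>i\<in>insert b B. d i *\<^sub>R v i)
        \<and> (\<forall>i\<in>insert b B. \<bar>d i\<bar> \<le> r i)"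
      using t c by (intro exI[of _ "c(b := t)"]) auto
  qed
  ultimately have "?A (insert b B) =
      (\<Union>x\<in>(\<lambda>t. t *\<^sub>R v b) ` {- r b..r b}. \<Union>y\<in>?A B. {x + y})" by (rule equalityI)
  then show ?case using compact_sums'[OF seg insert.IH] by simp
qed

text \<open>The sum is the orthogonal projection of \<open>f\<close> onto the span of
  \<open>E\<close>, written in an orthogonal but not normalized spanning set \<open>B\<close>. A
  zero vector in \<open>B\<close> does no harm, because its coefficient is 0 / 0 = 0.\<close>

lemma orthogonal_decomposition:
  fixes E :: "'h::real_inner set"
  assumes "finite E"
  obtains B where "finite B"
    "\<And>f e. e \<in> E \<union> B \<Longrightarrow> inner (f - (\<Sum>b\<in>B. (inner b f / inner b b) *\<^sub>R b)) e = 0"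
proof -
  obtain B where B: "finite B" "span B = span E" "pairwise orthogonal B"
    using basis_orthogonal[OF assms] by blast
  have "inner (f - (\<Sum>b\<in>B. (inner b f / inner b b) *\<^sub>R b)) e = 0" if "e \<in> E \<union> B" for f e
  proof -
    let ?P = "\<Sum>b\<in>B. (inner b f / inner b b) *\<^sub>R b"
    have "orthogonal (f - ?P) x" if x: "x \<in> B" for x
    proof -
      have "inner ?P x = (\<Sum>b\<in>B. if b = x then inner x f else 0)"
        unfolding inner_sum_left
        using B(3) x by (intro sum.cong) (auto simp: pairwise_def orthogonal_def)
      then show ?thesis
        using x B(1) by (simp add: orthogonal_def inner_diff_left inner_commute[of x f])
    qed
    moreover have "e \<in> span B" using B(2) that by (metis Un_iff span_base)
    ultimately show ?thesis
      using orthogonal_to_span[of e B "f - ?P"] by (simp add: orthogonal_def)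
  qed
  with B(1) show ?thesis by (rule that)
qed

text \<open>Split \<open>f\<close> into its projection \<open>P f\<close> onto the span of
  \<open>E\<close> and the rest. The vectors \<open>T (P f)\<close> stay in a compact set of bounded
  combinations, and the rest has an image of norm at most \<open>e / 8\<close>, so a finite net for
  the compact set is also a net for the whole image.\<close>

lemma compact_closure_image_ball:
  fixes T :: "'h::real_inner \<Rightarrow> 'k::{real_normed_vector,complete_space}"
  assumes T: "bounded_linear T" and small: "small_off_finite T"
  shows "compact (closure (T ` cball 0 1))"
proof -
  interpret T: bounded_linear T by fact
  have "\<exists>k. finite k \<and> closure (T ` cball 0 1) \<subseteq> (\<Union>x\<in>k. ball x e)" if e: "e > 0" for e :: real
  proof -
    obtain K where K: "\<And>x. norm (T x) \<le> norm x * K" "K \<ge> 0" using T.nonneg_bounded by blast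
    obtain E where E: "finite E"
      "\<And>g. (\<And>e. e \<in> E \<Longrightarrow> inner g e = 0) \<Longrightarrow> norm (T g) \<le> e / 8 * norm g"
      using small_off_finiteE[OF small, of "e / 8"] e by auto
    obtain B where B: "finite B"
      "\<And>f e. e \<in> E \<union> B \<Longrightarrow> inner (f - (\<Sum>b\<in>B. (inner b f / inner b b) *\<^sub>R b)) e = 0"
      using orthogonal_decomposition[OF E(1)] by blast
    define P where "P f = (\<Sum>b\<in>B. (inner b f / inner b b) *\<^sub>R b)" for f
    have P_norm: "norm (f - P f) \<le> norm f" for f
    proof -
      have "inner (P f) (f - P f) = 0"
        using B(2)[of _ f] by (subst P_def, subst inner_sum_left)
          (auto simp: P_def inner_commute intro!: sum.neutral)
      then have "(norm f)\<^sup>2 = (norm (P f))\<^sup>2 + (norm (f - P f))\<^sup>2"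
        using norm_add_Pythagorean[of "P f" "f - P f"] by (simp add: orthogonal_def)
      then have "(norm (f - P f))\<^sup>2 \<le> (norm f)\<^sup>2" by simp
      then show ?thesis by (rule power2_le_imp_le) simp
    qed
    \<comment> \<open>The bound \<open>1 / norm b\<close> is Cauchy-Schwarz for vectors of the unit
      ball; for \<open>b = 0\<close> the bound and the coefficient are both 0.\<close>
    define C where "C = {\<Sum>b\<in>B. c b *\<^sub>R T b |c. \<forall>b\<in>B. \<bar>c b\<bar> \<le> 1 / norm b}"
    have "compact C" unfolding C_def by (rule compact_box_combinations[OF B(1)])
    then obtain k where k: "finite k" "C \<subseteq> (\<Union>x\<in>k. ball x (e / 2))"
      using e unfolding compact_eq_totally_bounded by (metis half_gt_zero)
    have near: "\<exists>x\<in>k. dist x (T f) \<le> 3 / 4 * e" if f: "norm f \<le> 1" for f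
    proof -
      have "T (P f) = (\<Sum>b\<in>B. (inner b f / inner b b) *\<^sub>R T b)"
        by (simp add: P_def T.sum T.scaleR)
      moreover have "\<bar>inner b f / inner b b\<bar> \<le> 1 / norm b" for b
      proof (cases "b = 0")
        case False
        have "\<bar>inner b f\<bar> \<le> norm b * norm f" by (rule Cauchy_Schwarz_ineq2)
        also have "\<dots> \<le> norm b * 1" using f by (intro mult_left_mono) auto
        finally show ?thesis
          using False by (simp add: dot_square_norm power2_eq_square field_simps)
      qed simp
      ultimately have "T (P f) \<in> C"
        unfolding C_def by (intro CollectI exI[of _ "\<lambda>b. inner b f / inner b b"]) auto
      then obtain x where x: "x \<in> k" "dist x (T (P f)) < e / 2" using k(2) by auto
      have "norm (T (f - P f)) \<le> e / 8 * norm (f - P f)"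
        by (rule E(2)) (simp add: P_def B(2))
      also have "\<dots> \<le> e / 8 * 1"
        using e f P_norm[of f] by (intro mult_left_mono) auto
      finally have "dist (T (P f)) (T f) \<le> e / 8"
        by (simp add: T.diff dist_norm norm_minus_commute)
      then show ?thesis using x dist_triangle[of x "T f" "T (P f)"] e by (intro bexI[of _ x]) auto
    qed
    \<comment> \<open>Closed balls make the cover survive the closure. Their radius exceeds
      \<open>e / 2 + e / 8\<close> and is still below \<open>e\<close>.\<close>
    have "T ` cball 0 1 \<subseteq> (\<Union>x\<in>k. cball x (3 / 4 * e))"
      using near by (fastforce simp: dist_norm)
    moreover have "closed (\<Union>x\<in>k. cball x (3 / 4 * e))"
      using k(1) by (intro closed_UN) auto
    ultimately have "closure (T ` cball 0 1) \<subseteq> (\<Union>x\<in>k. cball x (3 / 4 * e))"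
      by (rule closure_minimal)
    also have "\<dots> \<subseteq> (\<Union>x\<in>k. ball x e)" using e by force
    finally show ?thesis using k(1) by blast
  qed
  then show ?thesis unfolding compact_eq_totally_bounded by (simp add: complete_eq_closed)
qed

section \<open>Finite orthonormal sets and bounded sums of squares\<close>

lemma bessel_inequality_finite:
  fixes x :: "'h::real_inner"
  assumes "finite E" "pairwise orthogonal E" "\<And>e. e \<in> E \<Longrightarrow> norm e = 1"
  shows "(\<Sum>e\<in>E. (inner e x)\<^sup>2) \<le> (norm x)\<^sup>2"
proof -
  define P where "P = (\<Sum>e\<in>E. inner e x *\<^sub>R e)"
  have ee: "inner e e = 1" if "e \<in> E" for e
    using assms(3)[OF that] by (simp add: norm_eq_1)
  have eP: "inner e P = inner e x" if "e \<in> E" for e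
  proof -
    have "inner e P = (\<Sum>d\<in>E. if d = e then inner e x else 0)"
      unfolding P_def inner_sum_right
      using assms(2) that ee by (intro sum.cong) (auto simp: pairwise_def orthogonal_def)
    then show ?thesis using that assms(1) by simp
  qed
  have xP: "inner x P = (\<Sum>e\<in>E. (inner e x)\<^sup>2)"
    unfolding P_def inner_sum_right by (simp add: power2_eq_square inner_commute)
  have PP: "inner P P = (\<Sum>e\<in>E. (inner e x)\<^sup>2)"
    by (subst (1) P_def, subst inner_sum_left) (simp add: eP power2_eq_square)
  have "0 \<le> inner (x - P) (x - P)" by simp
  also have "\<dots> = (norm x)\<^sup>2 - (\<Sum>e\<in>E. (inner e x)\<^sup>2)"
    by (simp add: inner_diff_left inner_diff_right inner_commute[of P x] xP PP power2_norm_eq_inner)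
  finally show ?thesis by simp
qed

text \<open>The exceptional set is a largest orthonormal set on which \<open>norm (T e)\<close>
  exceeds \<epsilon>. The bound \<open>M\<close> limits its cardinality, since every member
  contributes at least \<open>\<epsilon>\<^sup>2\<close>, and a unit vector orthogonal to it with a
  larger image would enlarge it.\<close>

lemma small_off_finite_if_sums_bounded:
  fixes T :: "'h::real_inner \<Rightarrow> 'k::real_normed_vector"
  assumes hom: "\<And>r x. T (r *\<^sub>R x) = r *\<^sub>R T x"
    and M: "\<And>E. finite E \<Longrightarrow> pairwise orthogonal E \<Longrightarrow> (\<And>e. e \<in> E \<Longrightarrow> norm e = 1)
      \<Longrightarrow> (\<Sum>e\<in>E. (norm (T e))\<^sup>2) \<le> M"
  shows "small_off_finite T"
  unfolding small_off_finite_def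
proof (intro allI impI)
  fix \<epsilon> :: real assume e: "\<epsilon> > 0"
  define Q where "Q E \<longleftrightarrow> finite E \<and> pairwise orthogonal E \<and> (\<forall>e\<in>E. norm e = 1 \<and> norm (T e) > \<epsilon>)" for E
  have card: "card E \<le> nat \<lceil>M / \<epsilon>\<^sup>2\<rceil>" if "Q E" for E
  proof -
    have "real (card E) * \<epsilon>\<^sup>2 = (\<Sum>e\<in>E. \<epsilon>\<^sup>2)" by simp
    also have "\<dots> \<le> (\<Sum>e\<in>E. (norm (T e))\<^sup>2)"
      using that e by (intro sum_mono power_mono) (auto simp: Q_def intro: less_imp_le)
    also have "\<dots> \<le> M" using that by (intro M) (auto simp: Q_def)
    finally have "real (card E) \<le> M / \<epsilon>\<^sup>2" using e by (simp add: field_simps)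
    then show ?thesis by linarith
  qed
  have "\<exists>E. Q E \<and> (\<forall>F. Q F \<longrightarrow> card F \<le> card E)"
  proof (rule ex_has_greatest_nat)
    show "Q {}" by (simp add: Q_def)
    show "\<forall>F. Q F \<longrightarrow> card F < Suc (nat \<lceil>M / \<epsilon>\<^sup>2\<rceil>)" using card by (auto simp: le_imp_less_Suc)
  qed
  then obtain E where E: "Q E" and max: "\<And>F. Q F \<Longrightarrow> card F \<le> card E" by blast
  have "norm (T g) \<le> \<epsilon> * norm g" if g: "\<forall>e\<in>E. inner g e = 0" for g
  proof (cases "g = 0")
    case True
    then show ?thesis using hom[of 0 0] by simp
  next
    case False
    define u where "u = g /\<^sub>R norm g"
    have u: "norm u = 1" "g = norm g *\<^sub>R u" using False by (simp_all add: u_def)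
    have uE: "inner e u = 0" "inner u e = 0" if "e \<in> E" for e
      using g that by (auto simp: u_def inner_commute)
    have "u \<notin> E" using uE(1)[of u] u(1) by (auto simp: norm_eq_1)
    have "norm (T u) \<le> \<epsilon>"
    proof (rule ccontr)
      assume "\<not> norm (T u) \<le> \<epsilon>"
      then have "Q (insert u E)"
        using E u uE by (auto simp: Q_def pairwise_insert orthogonal_def)
      then show False using max[of "insert u E"] \<open>u \<notin> E\<close> E by (simp add: Q_def)
    qed
    moreover have "norm (T g) = norm g * norm (T u)"
      by (subst u(2), subst hom) simp
    ultimately show ?thesis using mult_left_mono[of "norm (T u)" \<epsilon> "norm g"] by (simp add: mult.commute)
  qed
  then show "\<exists>E. finite E \<and> (\<forall>g. (\<forall>e\<in>E. inner g e = 0) \<longrightarrow> norm (T g) \<le> \<epsilon> * norm g)"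
    using E by (auto simp: Q_def)
qed

section \<open>Square-integrable functions\<close>

lemma square_integrable_diff:
  assumes "square_integrable f" "square_integrable g"
  shows "square_integrable (\<lambda>x. f x - g x)"
  using square_integrable_add[OF assms(1) square_integrable_cmult[OF assms(2), of "-1"]] by simp

lemma measurable_rep_L2 [measurable]: "rep_L2 f \<in> borel_measurable borel"
  using square_integrable_rep_L2[of f] by (simp add: square_integrable_def)

lemma rep_abs_L2_AE:
  assumes "square_integrable F"
  shows "AE x in lborel. rep_L2 (abs_L2 F) x = F x"
proof -
  have "L2_eq F F" using assms by (simp add: L2_eq_def)
  then have "L2_eq (rep_L2 (abs_L2 F)) F" by (rule rep_abs_rsp_left[OF Quotient3_L2])
  then show ?thesis by (simp add: L2_eq_def)
qed

lemma rep_plus_AE: "AE x in lborel. rep_L2 (f + g) x = rep_L2 f x + rep_L2 g x"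
  by (simp add: plus_L2_def rep_abs_L2_AE square_integrable_add square_integrable_rep_L2)

lemma rep_scaleC_AE: "AE x in lborel. rep_L2 (scaleC c f) x = c * rep_L2 f x"
  by (simp add: scaleC_def rep_abs_L2_AE square_integrable_cmult square_integrable_rep_L2)

lemma rep_minus_AE: "AE x in lborel. rep_L2 (f - g) x = rep_L2 f x - rep_L2 g x"
  using rep_plus_AE[of f "scaleC (-1) g"] rep_scaleC_AE[of "-1" g]
  unfolding minus_L2_def uminus_L2_def by eventually_elim simp

lemma cinner_rep: "cinner f g = (LINT x|lborel. rep_L2 f x * cnj (rep_L2 g x))"
  by (simp add: cinner_def)

lemma nn_integral_rep_L2: "(\<integral>\<^sup>+x. ennreal ((norm (rep_L2 f x))\<^sup>2) \<partial>lborel) = ennreal ((norm f)\<^sup>2)"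
proof -
  have "(norm f)\<^sup>2 = Re (cinner f f)" by (simp add: power2_norm_eq_inner inner_L2_def)
  also have "\<dots> = Re (LINT x|lborel. complex_of_real ((norm (rep_L2 f x))\<^sup>2))"
    by (simp only: cinner_rep complex_norm_square)
  also have "\<dots> = (LINT x|lborel. (norm (rep_L2 f x))\<^sup>2)"
    by (simp only: integral_complex_of_real Re_complex_of_real)
  finally show ?thesis
    using square_integrable_rep_L2[of f] by (simp add: square_integrable_def nn_integral_eq_integral)
qed

lemma cinner_add_left: "cinner (f + g) h = cinner f h + cinner g h"
proof -
  have "cinner (f + g) h = (LINT x|lborel. rep_L2 f x * cnj (rep_L2 h x) + rep_L2 g x
      * cnj (rep_L2 h x))"
    unfolding cinner_rep using rep_plus_AE[of f g] by (intro integral_cong_AE) (auto simp: distrib_right)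
  then show ?thesis by (simp add: cinner_rep square_integrable_mult_cnj square_integrable_rep_L2)
qed

lemma cinner_scaleC_left: "cinner (scaleC c f) g = c * cinner f g"
proof -
  have "cinner (scaleC c f) g = (LINT x|lborel. c * (rep_L2 f x * cnj (rep_L2 g x)))"
    unfolding cinner_rep using rep_scaleC_AE[of c f] by (intro integral_cong_AE) auto
  then show ?thesis by (simp add: cinner_rep)
qed

lemma cinner_commute: "cinner f g = cnj (cinner g f)"
proof -
  have "cinner f g = (LINT x|lborel. cnj (rep_L2 g x * cnj (rep_L2 f x)))"
    by (simp add: cinner_rep mult.commute)
  then show ?thesis by (simp only: Bochner_Integration.integral_cnj cinner_rep)
qed

lemma cinner_add_right: "cinner h (f + g) = cinner h f + cinner h g"
  by (metis cinner_add_left cinner_commute complex_cnj_add)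

lemma cinner_scaleC_right: "cinner g (scaleC c f) = cnj c * cinner g f"
  by (metis cinner_scaleC_left cinner_commute complex_cnj_mult)

lemma Re_cinner: "Re (cinner f g) = inner f g"
  by (simp add: inner_L2_def)

lemma cinner_eq_iff: "(\<forall>g. cinner f g = cinner h g) \<longleftrightarrow> f = h"
proof
  assume "\<forall>g. cinner f g = cinner h g"
  then have "inner f g = inner h g" for g by (simp flip: Re_cinner)
  then have "inner (f - h) g = 0" for g by (simp add: inner_diff_left)
  from this[of "f - h"] show "f = h" by simp
qed simp

lemma cinner_self: "cinner f f = of_real ((norm f)\<^sup>2)"
proof (rule complex_eqI)
  have "Im (cinner f f) = - Im (cinner f f)" by (subst (1) cinner_commute) simp
  then show "Im (cinner f f) = Im (of_real ((norm f)\<^sup>2))" by simp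
qed (simp add: Re_cinner power2_norm_eq_inner)

lemma norm_scaleC: "norm (scaleC c f) = cmod c * norm f"
proof -
  have "of_real ((norm (scaleC c f))\<^sup>2) = (c * cnj c) * cinner f f"
    by (simp only: cinner_self[symmetric] cinner_scaleC_left cinner_scaleC_right mult_ac)
  also have "\<dots> = complex_of_real ((cmod c * norm f)\<^sup>2)"
    by (simp only: cinner_self complex_norm_square[symmetric] power_mult_distrib of_real_mult)
  finally have "(norm (scaleC c f))\<^sup>2 = (cmod c * norm f)\<^sup>2" by (simp only: of_real_eq_iff)
  then show ?thesis by simp
qed

lemma cmod_cinner_le: "cmod (cinner f g) \<le> norm f * norm g"
proof -
  \<comment> \<open>Multiplying by this phase makes the inner product real and nonnegative and
    reduces the claim to the real Cauchy-Schwarz inequality. When the inner product is 0 the phase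
    is 0 as well, so only \<open>cmod c \<le> 1\<close> is used in the end.\<close>
  define c where "c = cnj (sgn (cinner f g))"
  have "c * cinner f g = of_real (cmod (cinner f g))"
    by (simp add: c_def sgn_div_norm scaleR_conv_of_real complex_norm_square[symmetric]
        power2_eq_square mult.commute[of _ "cinner f g"] mult.assoc[symmetric] complex_cnj_divide
        flip: divide_inverse)
  then have "cmod (cinner f g) = Re (c * cinner f g)" by simp
  also have "\<dots> = inner (scaleC c f) g" by (simp add: cinner_scaleC_left flip: Re_cinner)
  also have "\<dots> \<le> norm (scaleC c f) * norm g" by (rule norm_cauchy_schwarz)
  also have "\<dots> \<le> 1 * norm f * norm g"
    unfolding norm_scaleC by (intro mult_right_mono) (auto simp: c_def norm_sgn)
  finally show ?thesis by simp
qed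

section \<open>Completeness of the space of square-integrable classes\<close>

lemma summable_if_weighted_squares_finite:
  fixes y :: "nat \<Rightarrow> 'b::banach"
  assumes "(\<Sum>n. ennreal (2 ^ n * (norm (y n))\<^sup>2)) < \<infinity>"
  shows "summable y"
proof -
  have "summable (\<lambda>n. 2 ^ n * (norm (y n))\<^sup>2)"
    using assms by (intro summable_suminf_not_top) auto
  then have "summable (\<lambda>n. 2 ^ n * (norm (y n))\<^sup>2 + (1 / 2) ^ n)"
    by (intro summable_add summable_geometric) auto
  \<comment> \<open>If \<open>norm (y n)\<close> exceeds \<open>(1 / 2) ^ n\<close>, the first
    summand dominates it, otherwise the second does. In this way a bound on weighted squares, which
    integration in mean square provides, yields absolute convergence at a point.\<close>
  moreover have "norm (y n) \<le> 2 ^ n * (norm (y n))\<^sup>2 + (1 / 2) ^ n" for n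
  proof -
    have "0 \<le> (2 ^ n * norm (y n) - 1)\<^sup>2 + 2 ^ n * norm (y n)" by simp
    then have "2 ^ n * norm (y n) \<le> 2 ^ n * (2 ^ n * (norm (y n))\<^sup>2 + (1 / 2) ^ n)"
      by (simp add: power2_eq_square algebra_simps power_one_over)
    then show ?thesis by simp
  qed
  ultimately show ?thesis by (rule summable_comparison_test')
qed

text \<open>The Riesz-Fischer argument: a rapidly convergent subsequence converges almost
  everywhere, Fatou's lemma turns the pointwise limit into a limit in mean square, and a Cauchy
  sequence follows its subsequence.\<close>

instance L2 :: (euclidean_space) complete_space
proof
  fix X :: "nat \<Rightarrow> 'a L2" assume X: "Cauchy X"
  have "\<exists>N. \<forall>m\<ge>N. \<forall>n\<ge>N. norm (X m - X n) < (1 / 2) ^ k" for k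
    using X by (auto simp: Cauchy_def dist_norm)
  then obtain N where N: "\<And>k m n. m \<ge> N k \<Longrightarrow> n \<ge> N k \<Longrightarrow> norm (X m - X n) < (1 / 2) ^ k" by metis
  \<comment> \<open>The running maximum makes the chosen indices monotone in
    \<open>k\<close>.\<close>
  define r where "r k = Max (N ` {..k})" for k
  have r: "N k \<le> r k" "r k \<le> r (Suc k)" for k
    by (auto simp: r_def intro!: Max_mono Max_ge)
  have r_mono: "k \<le> l \<Longrightarrow> r k \<le> r l" for k l using r(2) by (rule lift_Suc_mono_le)
  have r_close: "norm (X (r k) - X (r l)) \<le> (1 / 2) ^ k" if "k \<le> l" for k l
    using N[of k "r k" "r l"] r(1)[of k] r_mono[OF that] by simp
  define F where "F k = rep_L2 (X (r k))" for k
  have F_meas [measurable]: "F k \<in> borel_measurable borel" for k by (simp add: F_def)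
  have F_dist: "(\<integral>\<^sup>+x. ennreal ((norm (F k x - F l x))\<^sup>2) \<partial>lborel)
      = ennreal ((norm (X (r k) - X (r l)))\<^sup>2)" for k l
    unfolding nn_integral_rep_L2[symmetric] F_def
    using rep_minus_AE[of "X (r k)" "X (r l)"] by (intro nn_integral_cong_AE) auto
  have "(\<integral>\<^sup>+x. (\<Sum>n. ennreal (2 ^ n * (norm (F (Suc n) x - F n x))\<^sup>2)) \<partial>lborel)
      = (\<Sum>n. \<integral>\<^sup>+x. ennreal (2 ^ n * (norm (F (Suc n) x - F n x))\<^sup>2) \<partial>lborel)"
    by (rule nn_integral_suminf) simp
  also have "\<dots> = (\<Sum>n. ennreal (2 ^ n * (norm (X (r (Suc n)) - X (r n)))\<^sup>2))"
    by (simp add: ennreal_mult nn_integral_cmult F_dist)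
  also have "\<dots> \<le> (\<Sum>n. ennreal ((1 / 2) ^ n))"
  proof (intro suminf_le ennreal_leI)
    fix n
    have "norm (X (r (Suc n)) - X (r n)) \<le> (1 / 2) ^ n"
      using r_close[of n "Suc n"] by (simp add: norm_minus_commute)
    then have "(norm (X (r (Suc n)) - X (r n)))\<^sup>2 \<le> ((1 / 2) ^ n)\<^sup>2" by (rule power_mono) simp
    then have "2 ^ n * (norm (X (r (Suc n)) - X (r n)))\<^sup>2 \<le> 2 ^ n * ((1 / 2) ^ n)\<^sup>2"
      by (rule mult_left_mono) simp
    then show "2 ^ n * (norm (X (r (Suc n)) - X (r n)))\<^sup>2 \<le> (1 / 2) ^ n"
      by (simp add: power2_eq_square power_one_over)
  qed auto
  also have "\<dots> < \<infinity>"
    by (subst suminf_ennreal2) (auto intro!: summable_geometric)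
  finally have "AE x in lborel. (\<Sum>n. ennreal (2 ^ n * (norm (F (Suc n) x - F n x))\<^sup>2)) \<noteq> \<infinity>"
    by (intro nn_integral_noteq_infinite) auto
  then have conv: "AE x in lborel. convergent (\<lambda>n. F n x)"
  proof eventually_elim
    case (elim x)
    then have "summable (\<lambda>n. F (Suc n) x - F n x)"
      by (intro summable_if_weighted_squares_finite) (auto simp: less_top)
    then have "convergent (\<lambda>n. F n x - F 0 x)"
      using sum_lessThan_telescope[of "\<lambda>n. F n x"] by (simp add: summable_iff_convergent)
    from convergent_add[OF this convergent_const[of "F 0 x"]] show ?case by simp
  qed
  \<comment> \<open>The points of divergence, where \<open>lim\<close> gives an unspecified value,
    form a null set.\<close>
  define f where "f x = lim (\<lambda>n. F n x)" for x
  have f_meas [measurable]: "f \<in> borel_measurable borel" unfolding f_def by measurable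
  have close: "(\<integral>\<^sup>+x. ennreal ((norm (F k x - f x))\<^sup>2) \<partial>lborel) \<le> ennreal (((1 / 2) ^ k)\<^sup>2)" for k
  proof -
    have "(\<integral>\<^sup>+x. ennreal ((norm (F k x - f x))\<^sup>2) \<partial>lborel)
        = (\<integral>\<^sup>+x. liminf (\<lambda>n. ennreal ((norm (F k x - F n x))\<^sup>2)) \<partial>lborel)"
    proof (rule nn_integral_cong_AE)
      show "AE x in lborel. ennreal ((norm (F k x - f x))\<^sup>2)
          = liminf (\<lambda>n. ennreal ((norm (F k x - F n x))\<^sup>2))"
        using conv
      proof eventually_elim
        case (elim x)
        then have "(\<lambda>n. F n x) \<longlonglongrightarrow> f x" by (simp add: f_def convergent_LIMSEQ_iff)
        then have "(\<lambda>n. ennreal ((norm (F k x - F n x))\<^sup>2)) \<longlonglongrightarrow> ennreal ((norm (F k x - f x))\<^sup>2)"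
          by (intro tendsto_intros tendsto_ennrealI)
        then show ?case by (rule lim_imp_Liminf[OF trivial_limit_sequentially, symmetric])
      qed
    qed
    also have "\<dots> \<le> liminf (\<lambda>n. \<integral>\<^sup>+x. ennreal ((norm (F k x - F n x))\<^sup>2) \<partial>lborel)"
      by (rule nn_integral_liminf) simp
    also have "\<dots> \<le> ennreal (((1 / 2) ^ k)\<^sup>2)"
    proof (rule Liminf_le)
      show "\<forall>\<^sub>F n in sequentially. (\<integral>\<^sup>+x. ennreal ((norm (F k x - F n x))\<^sup>2) \<partial>lborel)
          \<le> ennreal (((1 / 2) ^ k)\<^sup>2)"
        unfolding F_dist
        by (intro eventually_sequentiallyI[of k] ennreal_leI power_mono r_close) auto
    qed simp
    finally show ?thesis .
  qed
  have "square_integrable (\<lambda>x. F 0 x - f x)"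
    using le_less_trans[OF close[of 0]] by (simp add: square_integrable_def integrable_iff_bounded)
  from square_integrable_diff[OF square_integrable_rep_L2[of "X (r 0)"] this]
  have f: "square_integrable f" by (simp add: F_def)
  have lim: "norm (X (r k) - abs_L2 f) \<le> (1 / 2) ^ k" for k
  proof -
    have "ennreal ((norm (X (r k) - abs_L2 f))\<^sup>2) = (\<integral>\<^sup>+x. ennreal ((norm (F k x - f x))\<^sup>2) \<partial>lborel)"
      unfolding nn_integral_rep_L2[symmetric] F_def
      using rep_minus_AE[of "X (r k)" "abs_L2 f"] rep_abs_L2_AE[OF f]
      by (intro nn_integral_cong_AE) auto
    also have "\<dots> \<le> ennreal (((1 / 2) ^ k)\<^sup>2)" by (rule close)
    finally have "(norm (X (r k) - abs_L2 f))\<^sup>2 \<le> ((1 / 2) ^ k)\<^sup>2" by simp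
    then show ?thesis by (rule power2_le_imp_le) simp
  qed
  have "X \<longlonglongrightarrow> abs_L2 f"
  proof (rule metric_LIMSEQ_I)
    fix e :: real assume "e > 0"
    then obtain k where k: "(1 / 2) ^ k < e / 2"
      using real_arch_pow_inv[of "e / 2" "1 / 2"] by auto
    have "dist (X n) (abs_L2 f) < e" if "n \<ge> N k" for n
    proof -
      have "norm (X n - abs_L2 f) \<le> norm (X n - X (r k)) + norm (X (r k) - abs_L2 f)"
        using norm_triangle_ineq[of "X n - X (r k)" "X (r k) - abs_L2 f"] by simp
      then show ?thesis using N[OF that r(1)] lim[of k] k by (simp add: dist_norm)
    qed
    then show "\<exists>n0. \<forall>n\<ge>n0. dist (X n) (abs_L2 f) < e" by blast
  qed
  then show "convergent X" by (auto simp: convergent_def)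
qed

text \<open>The real Riesz theorem, applied to the real part of the antilinear functional, gives
  \<open>h\<close>. Testing with \<open>scaleC \<i> g\<close> then recovers the imaginary part,
  because both sides are antilinear in \<open>g\<close>.\<close>

lemma weak_representation:
  fixes F :: "'p \<Rightarrow> 'a::euclidean_space L2 \<Rightarrow> complex"
  assumes int: "\<And>g. integrable M (\<lambda>p. F p g)"
    and bound: "\<And>g. cmod (LINT p|M. F p g) \<le> K * norm g"
    and add: "\<And>p g h. F p (g + h) = F p g + F p h"
    and scale: "\<And>p c g. F p (scaleC c g) = cnj c * F p g"
  obtains h where "\<And>g. has_bochner_integral M (\<lambda>p. F p g) (cinner h g)"
proof -
  define l where "l g = (LINT p|M. F p g)" for g
  have l_add: "l (g + h) = l g + l h" for g h by (simp add: l_def add int)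
  have l_scale: "l (scaleC c g) = cnj c * l g" for c g by (simp add: l_def scale)
  have "bounded_linear (\<lambda>g. Re (l g))"
  proof (rule bounded_linear_intro[where K = K])
    show "norm (Re (l g)) \<le> norm g * K" for g
      using abs_Re_le_cmod[of "l g"] bound[of g] by (simp add: l_def mult.commute)
  qed (simp_all add: l_add l_scale scaleR_L2_def)
  from riesz_representation[OF this] obtain h where h: "\<And>g. Re (l g) = inner h g" by blast
  have "l g = cinner h g" for g
  proof (rule complex_eqI)
    show "Re (l g) = Re (cinner h g)" by (simp add: h Re_cinner)
    have "Re (l (scaleC \<i> g)) = Re (cinner h (scaleC \<i> g))" by (simp add: h Re_cinner)
    then show "Im (l g) = Im (cinner h g)" by (simp add: l_scale cinner_scaleC_right)
  qed
  then have "has_bochner_integral M (\<lambda>p. F p g) (cinner h g)" for g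
    using int[of g] by (metis has_bochner_integral_integrable l_def)
  then show ?thesis by (rule that)
qed

section \<open>Localization operators of families satisfying a Schur condition\<close>

lemma le_ennreal_if_power2_le:
  fixes x :: ennreal
  assumes "x\<^sup>2 \<le> ennreal (a\<^sup>2)" "0 \<le> a"
  shows "x \<le> ennreal a"
proof (cases x)
  case (real r)
  then have "r\<^sup>2 \<le> a\<^sup>2" using assms by (simp add: ennreal_power)
  then show ?thesis using real assms(2) by (auto intro!: ennreal_leI power2_le_imp_le[of r a])
next
  case top
  then show ?thesis using assms by (simp add: power2_eq_square ennreal_top_mult top_unique)
qed

lemma norm_has_bochner_integral_le:
  assumes "has_bochner_integral M f (x :: 'b::{banach,second_countable_topology})"
  shows "ennreal (norm x) \<le> (\<integral>\<^sup>+p. ennreal (norm (f p)) \<partial>M)"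
  using assms integral_norm_bound_ennreal[of M f] by (simp add: has_bochner_integral_iff)

text \<open>In the application \<open>v\<close> is the orbit of a wavelet under the group,
  \<open>w\<close> the scale weight and \<open>c\<close> the norm of the wavelet. The kernel is
  Hermitian, so the single bound \<open>schur\<close> serves for rows and for columns.\<close>

locale schur_family = sigma_finite_measure M
  for M :: "'p measure" +
  fixes v :: "'p \<Rightarrow> 'a::euclidean_space L2" and w :: "'p \<Rightarrow> real" and c C :: real
  assumes cinner_measurable: "\<And>f. (\<lambda>p. cinner f (v p)) \<in> borel_measurable M"
    and kernel_measurable: "(\<lambda>(p, q). cinner (v p) (v q)) \<in> borel_measurable (M \<Otimes>\<^sub>M M)"
    and w_measurable [measurable]: "w \<in> borel_measurable M"
    and w_pos: "\<And>p. p \<in> space M \<Longrightarrow> 0 < w p"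
    and v_bound: "\<And>p. p \<in> space M \<Longrightarrow> norm (v p) \<le> c"
    and c_nonneg: "0 \<le> c"
    and C_pos: "0 < C"
    and schur: "\<And>p. p \<in> space M \<Longrightarrow>
      (\<integral>\<^sup>+q. ennreal (cmod (cinner (v p) (v q)) * w q) \<partial>M) \<le> ennreal (C * w p)"
begin

lemma cinner_measurable_comp [measurable (raw)]:
  assumes "h \<in> measurable L M"
  shows "(\<lambda>x. cinner f (v (h x))) \<in> borel_measurable L"
  using measurable_compose[OF assms cinner_measurable] .

lemma cinner_measurable_comp' [measurable (raw)]:
  assumes [measurable]: "h \<in> measurable L M"
  shows "(\<lambda>x. cinner (v (h x)) f) \<in> borel_measurable L"
  by (subst cinner_commute) measurable

lemma kernel_measurable_comp [measurable (raw)]: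
  assumes "h \<in> measurable L M" "k \<in> measurable L M"
  shows "(\<lambda>x. cinner (v (h x)) (v (k x))) \<in> borel_measurable L"
  using measurable_compose[OF measurable_Pair[OF assms] kernel_measurable] by simp

lemma cmod_cinner_commute: "cmod (cinner f g) = cmod (cinner g f)"
  by (subst cinner_commute) simp

text \<open>Schur's test. The weight enters through the weighted arithmetic-geometric mean inequality.\<close>

lemma schur_bilinear:
  fixes x y \<tau> :: "'p \<Rightarrow> real"
  assumes [measurable]: "x \<in> borel_measurable M" "y \<in> borel_measurable M" "\<tau> \<in> borel_measurable M"
    and \<tau>: "AE q in M. \<bar>\<tau> q\<bar> \<le> s"
    and nonneg: "0 \<le> s" "0 \<le> A" and t: "0 < t"
    and rows: "\<And>p. p \<in> space M \<Longrightarrow> x p \<noteq> 0 \<Longrightarrow>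
      (\<integral>\<^sup>+q. ennreal (\<bar>\<tau> q\<bar> * cmod (cinner (v p) (v q)) * w q) \<partial>M) \<le> ennreal (A * w p)"
  shows "(\<integral>\<^sup>+q. \<integral>\<^sup>+p. ennreal (\<bar>x p\<bar> * \<bar>\<tau> q\<bar> * cmod (cinner (v p) (v q)) * \<bar>y q\<bar>) \<partial>M \<partial>M)
    \<le> ennreal (t * A / 2) * (\<integral>\<^sup>+p. ennreal ((x p)\<^sup>2) \<partial>M)
      + ennreal (s * C / (2 * t)) * (\<integral>\<^sup>+p. ennreal ((y p)\<^sup>2) \<partial>M)"
proof -
  interpret pair_sigma_finite M M ..
  define N where "N p q = cmod (cinner (v p) (v q))" for p q
  have N_measurable [measurable (raw)]: "(\<lambda>z. N (h z) (k z)) \<in> borel_measurable L"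
    if [measurable]: "h \<in> measurable L M" "k \<in> measurable L M" for h k and L :: "'l measure"
    unfolding N_def by measurable
  have N_nonneg: "0 \<le> N p q" for p q by (simp add: N_def)
  \<comment> \<open>The two halves of the weighted mean inequality: \<open>F\<close> carries
    \<open>x\<close> and is integrated over \<open>q\<close> first, by \<open>rows\<close>;
    \<open>G\<close> carries \<open>y\<close> and is integrated over \<open>p\<close> first, by
    \<open>schur\<close> at \<open>q\<close>, hence the swapped arguments in
    \<open>N q p\<close>.\<close>
  define F where "F p q = ennreal (t * (x p)\<^sup>2 / (2 * w p)) * ennreal (\<bar>\<tau> q\<bar> * N p q * w q)" for p q
  define G where "G p q = ennreal (\<bar>\<tau> q\<bar> * (y q)\<^sup>2 / (2 * t * w q)) * ennreal (N q p * w p)" for p q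
  have F_measurable [measurable (raw)]: "(\<lambda>z. F (h z) (k z)) \<in> borel_measurable L"
    if [measurable]: "h \<in> measurable L M" "k \<in> measurable L M" for h k and L :: "'l measure"
    unfolding F_def by measurable
  have G_measurable [measurable (raw)]: "(\<lambda>z. G (h z) (k z)) \<in> borel_measurable L"
    if [measurable]: "h \<in> measurable L M" "k \<in> measurable L M" for h k and L :: "'l measure"
    unfolding G_def by measurable
  have pointwise: "ennreal (\<bar>x p\<bar> * \<bar>\<tau> q\<bar> * N p q * \<bar>y q\<bar>) \<le> F p q + G p q"
    if "p \<in> space M" "q \<in> space M" for p q
  proof -
    have w: "0 < w p" "0 < w q" using that w_pos by auto
    have "0 \<le> (t * \<bar>x p\<bar> * w q - \<bar>y q\<bar> * w p)\<^sup>2" by simp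
    then have "2 * (t * w p * w q) * (\<bar>x p\<bar> * \<bar>y q\<bar>) \<le> t\<^sup>2 * (x p)\<^sup>2 * (w q)\<^sup>2 + (y q)\<^sup>2 * (w p)\<^sup>2"
      by (simp add: power2_diff power_mult_distrib algebra_simps)
    then have "\<bar>x p\<bar> * \<bar>y q\<bar> \<le> t * (x p)\<^sup>2 / (2 * w p) * w q + (y q)\<^sup>2 / (2 * t * w q) * w p"
      using w t by (simp add: field_simps power2_eq_square)
    then have "\<bar>\<tau> q\<bar> * N p q * (\<bar>x p\<bar> * \<bar>y q\<bar>)
        \<le> \<bar>\<tau> q\<bar> * N p q * (t * (x p)\<^sup>2 / (2 * w p) * w q + (y q)\<^sup>2 / (2 * t * w q) * w p)"
      by (rule mult_left_mono) (simp add: N_nonneg)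
    also have "\<dots> = t * (x p)\<^sup>2 / (2 * w p) * (\<bar>\<tau> q\<bar> * N p q * w q)
        + \<bar>\<tau> q\<bar> * (y q)\<^sup>2 / (2 * t * w q) * (N q p * w p)"
      by (simp add: algebra_simps N_def cmod_cinner_commute[of "v q"])
    finally have "ennreal (\<bar>x p\<bar> * \<bar>\<tau> q\<bar> * N p q * \<bar>y q\<bar>)
        \<le> ennreal (t * (x p)\<^sup>2 / (2 * w p) * (\<bar>\<tau> q\<bar> * N p q * w q)
        + \<bar>\<tau> q\<bar> * (y q)\<^sup>2 / (2 * t * w q) * (N q p * w p))"
      by (intro ennreal_leI) (simp add: algebra_simps)
    also have "\<dots> = F p q + G p q"
      using w t N_nonneg by (simp add: F_def G_def ennreal_mult[symmetric])
    finally show ?thesis .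
  qed
  have "(\<integral>\<^sup>+q. \<integral>\<^sup>+p. ennreal (\<bar>x p\<bar> * \<bar>\<tau> q\<bar> * N p q * \<bar>y q\<bar>) \<partial>M \<partial>M)
      \<le> (\<integral>\<^sup>+q. \<integral>\<^sup>+p. F p q + G p q \<partial>M \<partial>M)"
    by (intro nn_integral_mono pointwise)
  also have "\<dots> = (\<integral>\<^sup>+q. (\<integral>\<^sup>+p. F p q \<partial>M) + (\<integral>\<^sup>+p. G p q \<partial>M) \<partial>M)"
    by (intro nn_integral_cong nn_integral_add) measurable
  also have "\<dots> = (\<integral>\<^sup>+q. \<integral>\<^sup>+p. F p q \<partial>M \<partial>M) + (\<integral>\<^sup>+q. \<integral>\<^sup>+p. G p q \<partial>M \<partial>M)"
    by (intro nn_integral_add) measurable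
  also have "(\<integral>\<^sup>+q. \<integral>\<^sup>+p. F p q \<partial>M \<partial>M) = (\<integral>\<^sup>+p. \<integral>\<^sup>+q. F p q \<partial>M \<partial>M)"
    by (rule Fubini') measurable
  also have "\<dots> \<le> (\<integral>\<^sup>+p. ennreal (t * A / 2) * ennreal ((x p)\<^sup>2) \<partial>M)"
  proof (rule nn_integral_mono)
    fix p assume p: "p \<in> space M"
    show "(\<integral>\<^sup>+q. F p q \<partial>M) \<le> ennreal (t * A / 2) * ennreal ((x p)\<^sup>2)"
    \<comment> \<open>The row bound is assumed only where \<open>x\<close> does not vanish;
      elsewhere \<open>F\<close> is 0.\<close>
    proof (cases "x p = 0")
      case True
      then show ?thesis by (simp add: F_def)
    next
      case False
      have "(\<integral>\<^sup>+q. F p q \<partial>M) = ennreal (t * (x p)\<^sup>2 / (2 * w p))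
          * (\<integral>\<^sup>+q. ennreal (\<bar>\<tau> q\<bar> * N p q * w q) \<partial>M)"
        unfolding F_def using p by (intro nn_integral_cmult) measurable
      also have "\<dots> \<le> ennreal (t * (x p)\<^sup>2 / (2 * w p)) * ennreal (A * w p)"
        using rows[OF p False] by (intro mult_left_mono) (auto simp: N_def)
      also have "\<dots> = ennreal (t * A / 2) * ennreal ((x p)\<^sup>2)"
        using w_pos[OF p] t nonneg by (simp add: ennreal_mult[symmetric])
      finally show ?thesis .
    qed
  qed
  also have "\<dots> = ennreal (t * A / 2) * (\<integral>\<^sup>+p. ennreal ((x p)\<^sup>2) \<partial>M)"
    by (rule nn_integral_cmult) measurable
  also have "(\<integral>\<^sup>+q. \<integral>\<^sup>+p. G p q \<partial>M \<partial>M) \<le> (\<integral>\<^sup>+q. ennreal (s * C / (2 * t)) * ennreal ((y q)\<^sup>2) \<partial>M)"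
  proof (rule nn_integral_mono_AE)
    show "AE q in M. (\<integral>\<^sup>+p. G p q \<partial>M) \<le> ennreal (s * C / (2 * t)) * ennreal ((y q)\<^sup>2)"
      using \<tau> AE_space
    proof eventually_elim
      case (elim q)
      have w: "0 < w q" using w_pos[OF elim(2)] .
      have "(\<integral>\<^sup>+p. G p q \<partial>M) = ennreal (\<bar>\<tau> q\<bar> * (y q)\<^sup>2 / (2 * t * w q))
          * (\<integral>\<^sup>+p. ennreal (N q p * w p) \<partial>M)"
        unfolding G_def using elim(2) by (intro nn_integral_cmult) measurable
      also have "\<dots> \<le> ennreal (s * (y q)\<^sup>2 / (2 * t * w q)) * ennreal (C * w q)"
        using schur[OF elim(2)] elim(1) w t
        by (intro mult_mono ennreal_leI divide_right_mono mult_right_mono) (auto simp: N_def)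
      also have "\<dots> = ennreal (s * C / (2 * t)) * ennreal ((y q)\<^sup>2)"
        using w t nonneg C_pos by (simp add: ennreal_mult[symmetric])
      finally show ?case .
    qed
  qed
  also have "\<dots> = ennreal (s * C / (2 * t)) * (\<integral>\<^sup>+p. ennreal ((y p)\<^sup>2) \<partial>M)"
    by (rule nn_integral_cmult) measurable
  finally show ?thesis by (simp add: N_def add_mono)
qed

section \<open>Boundedness of the analysis map\<close>

lemma synthesis_exists:
  assumes [measurable]: "u \<in> borel_measurable M"
    and bound: "\<And>g. (\<integral>\<^sup>+p. ennreal (cmod (u p * cinner (v p) g)) \<partial>M) \<le> ennreal (B * norm g)"
    and "0 \<le> B"
  obtains h where "\<And>g. has_bochner_integral M (\<lambda>p. u p * cinner (v p) g) (cinner h g)"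
proof (rule weak_representation[of M "\<lambda>p g. u p * cinner (v p) g" B])
  show "integrable M (\<lambda>p. u p * cinner (v p) g)" for g
    using le_less_trans[OF bound[of g]] by (intro integrableI_bounded) auto
  then have "ennreal (cmod (LINT p|M. u p * cinner (v p) g)) \<le> ennreal (B * norm g)" for g
    by (rule order_trans[OF integral_norm_bound_ennreal bound])
  then show "cmod (LINT p|M. u p * cinner (v p) g) \<le> B * norm g" for g
    using \<open>0 \<le> B\<close> by simp
qed (auto simp: cinner_add_right cinner_scaleC_right distrib_left that)

text \<open>Let \<open>u\<close> be the coefficients of \<open>f\<close> cut off to \<open>K\<close>
  and \<open>h\<close> their synthesis. The integral \<open>I\<close> of the squared coefficients
  equals \<open>inner h f\<close>, while Schur's test bounds the squared norm of \<open>h\<close> by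
  \<open>C * I\<close>. Cauchy-Schwarz then bounds the square of \<open>I\<close> by
  \<open>C * I * (norm f)\<^sup>2\<close>, where \<open>I\<close> cancels because it is
  finite.\<close>

lemma bessel_on_finite_measure:
  assumes K [measurable]: "K \<in> sets M" and fin: "emeasure M K < \<infinity>"
  shows "(\<integral>\<^sup>+p. ennreal ((cmod (cinner f (v p)))\<^sup>2) * indicator K p \<partial>M) \<le> ennreal (C * (norm f)\<^sup>2)"
proof -
  define u where "u p = indicator K p * cinner f (v p)" for p
  have u_measurable [measurable]: "u \<in> borel_measurable M" unfolding u_def by measurable
  \<comment> \<open>This crude bound depends on the measure of \<open>K\<close>. It serves to obtain
    \<open>h\<close> and disappears from the final estimate.\<close>
  have "(\<integral>\<^sup>+p. ennreal (cmod (u p * cinner (v p) g)) \<partial>M)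
      \<le> ennreal (norm f * c * c * measure M K * norm g)" for g
  proof -
    have "(\<integral>\<^sup>+p. ennreal (cmod (u p * cinner (v p) g)) \<partial>M)
        \<le> (\<integral>\<^sup>+p. ennreal (norm f * c * (c * norm g)) * indicator K p \<partial>M)"
    proof (rule nn_integral_mono)
      fix p assume p: "p \<in> space M"
      have "cmod (cinner f (v p)) \<le> norm f * c"
        using cmod_cinner_le[of f "v p"] mult_left_mono[OF v_bound[OF p], of "norm f"] by simp
      moreover have "cmod (cinner (v p) g) \<le> c * norm g"
        using cmod_cinner_le[of "v p" g] mult_right_mono[OF v_bound[OF p], of "norm g"] by simp
      ultimately have "cmod (cinner f (v p)) * cmod (cinner (v p) g) \<le> norm f * c * (c * norm g)"
        by (intro mult_mono) (auto simp: c_nonneg)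
      then show "ennreal (cmod (u p * cinner (v p) g))
          \<le> ennreal (norm f * c * (c * norm g)) * indicator K p"
        by (auto simp: u_def norm_mult indicator_def intro!: ennreal_leI)
    qed
    also have "\<dots> = ennreal (norm f * c * (c * norm g)) * ennreal (measure M K)"
      using fin by (simp add: nn_integral_cmult_indicator emeasure_eq_ennreal_measure)
    also have "\<dots> = ennreal (norm f * c * c * measure M K * norm g)"
      by (simp add: ennreal_mult[symmetric] c_nonneg mult_ac)
    finally show ?thesis .
  qed
  from synthesis_exists[OF u_measurable this] obtain h
    where h: "\<And>g. has_bochner_integral M (\<lambda>p. u p * cinner (v p) g) (cinner h g)"
    by (auto simp: c_nonneg)
  define I where "I = inner h f"
  have "u p * cinner (v p) f = of_real (indicator K p * (cmod (cinner f (v p)))\<^sup>2)" for p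
    unfolding u_def by (subst (2) cinner_commute) (simp add: complex_norm_square[symmetric] indicator_def)
  with h[of f] have "has_bochner_integral M (\<lambda>p. complex_of_real (indicator K p
      * (cmod (cinner f (v p)))\<^sup>2)) (cinner h f)"
    by simp
  then have "has_bochner_integral M (\<lambda>p. Re (complex_of_real (indicator K p
      * (cmod (cinner f (v p)))\<^sup>2))) (Re (cinner h f))"
    by (rule has_bochner_integral_Re)
  then have "has_bochner_integral M (\<lambda>p. indicator K p * (cmod (cinner f (v p)))\<^sup>2) I"
    by (simp add: Re_cinner I_def)
  then have I: "(\<integral>\<^sup>+p. ennreal (indicator K p * (cmod (cinner f (v p)))\<^sup>2) \<partial>M) = ennreal I" "0 \<le> I"
    by (auto simp: has_bochner_integral_iff nn_integral_eq_integral intro!: integral_nonneg_AE)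
  have u2: "(\<integral>\<^sup>+p. ennreal ((cmod (u p))\<^sup>2) \<partial>M) = ennreal I"
    unfolding I(1)[symmetric] by (intro nn_integral_cong) (auto simp: u_def norm_mult indicator_def)
  have hq: "ennreal (cmod (cinner h (v q)))
      \<le> (\<integral>\<^sup>+p. ennreal (cmod (u p) * cmod (cinner (v p) (v q))) \<partial>M)" for q
    using norm_has_bochner_integral_le[OF h[of "v q"]] by (simp add: norm_mult)
  have "ennreal ((norm h)\<^sup>2) = ennreal (cmod (cinner h h))"
    by (simp add: cinner_self norm_power)
  also have "\<dots> \<le> (\<integral>\<^sup>+q. ennreal (cmod (u q * cinner (v q) h)) \<partial>M)"
    by (rule norm_has_bochner_integral_le[OF h])
  also have "\<dots> = (\<integral>\<^sup>+q. ennreal (cmod (u q)) * ennreal (cmod (cinner h (v q))) \<partial>M)"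
    by (simp add: norm_mult ennreal_mult cmod_cinner_commute[of h])
  also have "\<dots> \<le> (\<integral>\<^sup>+q. ennreal (cmod (u q))
      * (\<integral>\<^sup>+p. ennreal (cmod (u p) * cmod (cinner (v p) (v q))) \<partial>M) \<partial>M)"
    by (intro nn_integral_mono mult_left_mono hq) simp
  also have "\<dots> = (\<integral>\<^sup>+q. \<integral>\<^sup>+p. ennreal (\<bar>cmod (u p)\<bar> * \<bar>1\<bar> * cmod (cinner (v p) (v q))
      * \<bar>cmod (u q)\<bar>) \<partial>M \<partial>M)"
    by (intro nn_integral_cong, subst nn_integral_cmult[symmetric])
       (auto simp: ennreal_mult[symmetric] mult_ac)
  \<comment> \<open>Schur's test with equal arguments, constant symbol 1 and balance
    \<open>t = 1\<close>; the two halves add up to \<open>C * I\<close>.\<close>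
  also have "\<dots> \<le> ennreal (1 * C / 2) * ennreal I + ennreal (1 * C / (2 * 1)) * ennreal I"
    unfolding u2[symmetric] by (rule schur_bilinear) (use C_pos schur in auto)
  also have "\<dots> = ennreal (C * I)"
    using C_pos I(2) by (simp add: ennreal_mult[symmetric] ennreal_plus[symmetric] del: ennreal_plus)
  finally have h_norm: "(norm h)\<^sup>2 \<le> C * I" using C_pos I(2) by simp
  have "I\<^sup>2 \<le> (norm h * norm f)\<^sup>2"
    unfolding I_def by (rule power_mono[OF norm_cauchy_schwarz]) (use I(2) I_def in simp)
  also have "\<dots> \<le> C * I * (norm f)\<^sup>2"
    unfolding power_mult_distrib by (intro mult_right_mono h_norm) simp
  finally have "I * I \<le> I * (C * (norm f)\<^sup>2)" by (simp add: power2_eq_square mult_ac)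
  then have "I \<le> C * (norm f)\<^sup>2"
    using I(2) C_pos by (cases "I = 0") (auto simp: mult_le_cancel_left)
  then have "ennreal I \<le> ennreal (C * (norm f)\<^sup>2)" by (rule ennreal_leI)
  also have "ennreal I = (\<integral>\<^sup>+p. ennreal ((cmod (cinner f (v p)))\<^sup>2) * indicator K p \<partial>M)"
    unfolding I(1)[symmetric] by (intro nn_integral_cong) (auto simp: indicator_def)
  finally show ?thesis .
qed

lemma bessel: "(\<integral>\<^sup>+p. ennreal ((cmod (cinner f (v p)))\<^sup>2) \<partial>M) \<le> ennreal (C * (norm f)\<^sup>2)"
proof -
  obtain A :: "nat \<Rightarrow> 'p set" where A: "range A \<subseteq> sets M" "(\<Union>i. A i) = space M"
    "\<And>i. emeasure M (A i) \<noteq> \<infinity>" "incseq A"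
    using sigma_finite_incseq by blast
  let ?F = "\<lambda>p. ennreal ((cmod (cinner f (v p)))\<^sup>2)"
  have "(\<integral>\<^sup>+p. ?F p \<partial>M) = (\<integral>\<^sup>+p. ?F p * indicator (space M) p \<partial>M)"
    by (intro nn_integral_cong) simp
  \<comment> \<open>The squared coefficients are viewed as the density of a measure, so that
    continuity from below along the exhaustion \<open>A\<close> applies.\<close>
  also have "\<dots> = emeasure (density M ?F) (\<Union>i. A i)"
    unfolding A(2) by (subst emeasure_density) auto
  also have "\<dots> = (SUP i. emeasure (density M ?F) (A i))"
    using A by (intro SUP_emeasure_incseq[symmetric]) auto
  also have "\<dots> \<le> ennreal (C * (norm f)\<^sup>2)"
  proof (rule SUP_least)
    fix i
    have "A i \<in> sets M" "emeasure M (A i) < \<infinity>" using A by (auto simp: less_top)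
    from bessel_on_finite_measure[OF this]
    show "emeasure (density M ?F) (A i) \<le> ennreal (C * (norm f)\<^sup>2)"
      using \<open>A i \<in> sets M\<close> by (simp add: emeasure_density)
  qed
  finally show ?thesis .
qed

section \<open>Localization operators with bounded symbols\<close>

definition loc_op :: "('p \<Rightarrow> real) \<Rightarrow> 'a L2 \<Rightarrow> 'a L2" where
  "loc_op \<tau> f = (THE h. \<forall>g. has_bochner_integral M
     (\<lambda>p. cinner (scaleC (complex_of_real (\<tau> p) * cinner f (v p)) (v p)) g) (cinner h g))"

text \<open>The bound is required to be positive because it occurs as a divisor later; a bound of 0
  can always be enlarged.\<close>

definition symbol_bounded :: "('p \<Rightarrow> real) \<Rightarrow> real \<Rightarrow> bool" where
  "symbol_bounded \<tau> s \<longleftrightarrow> \<tau> \<in> borel_measurable M \<and> (AE p in M. \<bar>\<tau> p\<bar> \<le> s) \<and> 0 < s"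

lemma symbol_bounded_measurable: "symbol_bounded \<tau> s \<Longrightarrow> \<tau> \<in> borel_measurable M"
  by (simp add: symbol_bounded_def)

text \<open>Cauchy-Schwarz with the whole symbol put on the side of \<open>f\<close>; the side of
  \<open>g\<close> is estimated by \<open>bessel\<close>. The bound \<open>J\<close> stays free so
  that energies much smaller than the general bound can be inserted.\<close>

lemma pairing_cauchy_schwarz:
  assumes [measurable]: "\<tau> \<in> borel_measurable M"
    and J: "(\<integral>\<^sup>+p. ennreal ((\<tau> p * cmod (cinner f (v p)))\<^sup>2) \<partial>M) \<le> ennreal J" "0 \<le> J"
  shows "(\<integral>\<^sup>+p. ennreal (cmod (complex_of_real (\<tau> p) * cinner f (v p) * cinner (v p) g)) \<partial>M)
    \<le> ennreal (sqrt (J * C) * norm g)"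
proof (rule le_ennreal_if_power2_le)
  have "(\<integral>\<^sup>+p. ennreal (cmod (complex_of_real (\<tau> p) * cinner f (v p) * cinner (v p) g)) \<partial>M)\<^sup>2
      = (\<integral>\<^sup>+p. ennreal (\<bar>\<tau> p\<bar> * cmod (cinner f (v p))) * ennreal (cmod (cinner g (v p))) \<partial>M)\<^sup>2"
    by (simp add: norm_mult ennreal_mult cmod_cinner_commute[of g])
  also have "\<dots> \<le> (\<integral>\<^sup>+p. (ennreal (\<bar>\<tau> p\<bar> * cmod (cinner f (v p))))\<^sup>2 \<partial>M)
      * (\<integral>\<^sup>+p. (ennreal (cmod (cinner g (v p))))\<^sup>2 \<partial>M)"
    by (rule Cauchy_Schwarz_nn_integral) measurable
  also have "\<dots> = (\<integral>\<^sup>+p. ennreal ((\<tau> p * cmod (cinner f (v p)))\<^sup>2) \<partial>M)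
      * (\<integral>\<^sup>+p. ennreal ((cmod (cinner g (v p)))\<^sup>2) \<partial>M)"
    by (simp add: ennreal_power power_mult_distrib)
  also have "\<dots> \<le> ennreal J * ennreal (C * (norm g)\<^sup>2)"
    by (intro mult_mono J bessel) auto
  also have "\<dots> = ennreal ((sqrt (J * C) * norm g)\<^sup>2)"
    using J C_pos by (simp add: ennreal_mult[symmetric] power_mult_distrib mult.assoc)
  finally show "(\<integral>\<^sup>+p. ennreal (cmod (complex_of_real (\<tau> p) * cinner f (v p) * cinner (v p) g)) \<partial>M)\<^sup>2
      \<le> ennreal ((sqrt (J * C) * norm g)\<^sup>2)" .
  show "0 \<le> sqrt (J * C) * norm g" using J C_pos by simp
qed

lemma symbol_energy_le:
  assumes \<tau>: "symbol_bounded \<tau> s"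
  shows "(\<integral>\<^sup>+p. ennreal ((\<tau> p * cmod (cinner f (v p)))\<^sup>2) \<partial>M)
    \<le> ennreal (s\<^sup>2) * (\<integral>\<^sup>+p. ennreal ((cmod (cinner f (v p)))\<^sup>2) \<partial>M)"
proof -
  have "(\<integral>\<^sup>+p. ennreal ((\<tau> p * cmod (cinner f (v p)))\<^sup>2) \<partial>M)
      \<le> (\<integral>\<^sup>+p. ennreal (s\<^sup>2) * ennreal ((cmod (cinner f (v p)))\<^sup>2) \<partial>M)"
  proof (rule nn_integral_mono_AE)
    have "AE p in M. \<bar>\<tau> p\<bar> \<le> s" using \<tau> by (simp add: symbol_bounded_def)
    then show "AE p in M. ennreal ((\<tau> p * cmod (cinner f (v p)))\<^sup>2)
        \<le> ennreal (s\<^sup>2) * ennreal ((cmod (cinner f (v p)))\<^sup>2)"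
    proof eventually_elim
      case (elim p)
      then have "(\<tau> p)\<^sup>2 \<le> s\<^sup>2" using power_mono[of "\<bar>\<tau> p\<bar>" s 2] by simp
      then show ?case
        by (simp add: ennreal_mult[symmetric] power_mult_distrib mult_right_mono ennreal_leI)
    qed
  qed
  also have "\<dots> = ennreal (s\<^sup>2) * (\<integral>\<^sup>+p. ennreal ((cmod (cinner f (v p)))\<^sup>2) \<partial>M)"
    by (rule nn_integral_cmult) measurable
  finally show ?thesis .
qed

lemma symbol_energy_le':
  assumes \<tau>: "symbol_bounded \<tau> s"
  shows "(\<integral>\<^sup>+p. ennreal ((\<tau> p * cmod (cinner f (v p)))\<^sup>2) \<partial>M) \<le> ennreal (s\<^sup>2 * (C * (norm f)\<^sup>2))"
proof -
  have "(\<integral>\<^sup>+p. ennreal ((\<tau> p * cmod (cinner f (v p)))\<^sup>2) \<partial>M) \<le> ennreal (s\<^sup>2) * ennreal (C * (norm f)\<^sup>2)"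
    by (rule order_trans[OF symbol_energy_le[OF \<tau>]]) (intro mult_left_mono bessel, simp)
  then show ?thesis using C_pos by (simp add: ennreal_mult[symmetric])
qed

text \<open>This makes the definite description usable: the vector exists by the Riesz theorem and
  is unique because its inner products determine it.\<close>

lemma loc_op_weak:
  assumes \<tau>: "symbol_bounded \<tau> s"
  shows "has_bochner_integral M (\<lambda>p. complex_of_real (\<tau> p) * cinner f (v p)
      * cinner (v p) g) (cinner (loc_op \<tau> f) g)"
proof -
  have [measurable]: "\<tau> \<in> borel_measurable M" using \<tau> by (rule symbol_bounded_measurable)
  have "(\<lambda>p. complex_of_real (\<tau> p) * cinner f (v p)) \<in> borel_measurable M" by measurable
  from synthesis_exists[OF this pairing_cauchy_schwarz[OF _ symbol_energy_le'[OF \<tau>]]]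
  obtain h where h: "\<And>g. has_bochner_integral M
      (\<lambda>p. complex_of_real (\<tau> p) * cinner f (v p) * cinner (v p) g) (cinner h g)"
    using C_pos by auto
  have "loc_op \<tau> f = h"
    unfolding loc_op_def cinner_scaleC_left
  proof (rule the_equality)
    fix h' assume "\<forall>g. has_bochner_integral M
      (\<lambda>p. complex_of_real (\<tau> p) * cinner f (v p) * cinner (v p) g) (cinner h' g)"
    then have "\<forall>g. cinner h' g = cinner h g" using h has_bochner_integral_eq by blast
    then show "h' = h" by (simp add: cinner_eq_iff)
  qed (use h in blast)
  then show ?thesis using h by simp
qed

lemma loc_op_eqI:
  assumes "symbol_bounded \<tau> s"
    and "\<And>g. has_bochner_integral M (\<lambda>p. complex_of_real (\<tau> p) * cinner f (v p)
        * cinner (v p) g) (cinner h g)"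
  shows "loc_op \<tau> f = h"
  using has_bochner_integral_eq[OF loc_op_weak[OF assms(1)] assms(2)] cinner_eq_iff by blast

lemma loc_op_add: "symbol_bounded \<tau> s \<Longrightarrow> loc_op \<tau> (f + g) = loc_op \<tau> f + loc_op \<tau> g"
  using has_bochner_integral_add[OF loc_op_weak loc_op_weak]
  by (intro loc_op_eqI) (auto simp: cinner_add_left algebra_simps)

lemma loc_op_scaleC: "symbol_bounded \<tau> s \<Longrightarrow> loc_op \<tau> (scaleC r f) = scaleC r (loc_op \<tau> f)"
  using has_bochner_integral_mult_right[where c = r, OF loc_op_weak]
  by (intro loc_op_eqI) (auto simp: cinner_scaleC_left mult_ac)

lemma loc_op_scaleR: "symbol_bounded \<tau> s \<Longrightarrow> loc_op \<tau> (r *\<^sub>R f) = r *\<^sub>R loc_op \<tau> f"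
  by (simp add: scaleR_L2_def loc_op_scaleC)

lemma loc_op_add_symbol:
  assumes "symbol_bounded \<tau> s" "symbol_bounded \<tau>' s'" "symbol_bounded (\<lambda>p. \<tau> p + \<tau>' p) s''"
  shows "loc_op (\<lambda>p. \<tau> p + \<tau>' p) f = loc_op \<tau> f + loc_op \<tau>' f"
  using has_bochner_integral_add[OF loc_op_weak[OF assms(1)] loc_op_weak[OF assms(2)]]
  by (intro loc_op_eqI[OF assms(3)]) (auto simp: cinner_add_left algebra_simps)

text \<open>Conjugating the weak formula exchanges \<open>f\<close> and \<open>g\<close>, because
  the symbol is real.\<close>

lemma loc_op_symmetric:
  assumes "symbol_bounded \<tau> s"
  shows "inner (loc_op \<tau> f) g = inner f (loc_op \<tau> g)"
proof -
  have "has_bochner_integral M (\<lambda>p. cnj (complex_of_real (\<tau> p) * cinner f (v p)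
      * cinner (v p) g)) (cnj (cinner (loc_op \<tau> f) g))"
    by (rule has_bochner_integral_cnj[OF loc_op_weak[OF assms]])
  moreover have "cnj (complex_of_real (\<tau> p) * cinner f (v p) * cinner (v p) g)
      = complex_of_real (\<tau> p) * cinner g (v p) * cinner (v p) f" for p
    using cinner_commute[of "v p" f] cinner_commute[of g "v p"] by simp
  ultimately have "has_bochner_integral M (\<lambda>p. complex_of_real (\<tau> p) * cinner g (v p)
      * cinner (v p) f) (cnj (cinner (loc_op \<tau> f) g))"
    by (simp only:)
  then have "cnj (cinner (loc_op \<tau> f) g) = cinner (loc_op \<tau> g) f"
    by (rule has_bochner_integral_eq[OF _ loc_op_weak[OF assms]])
  then have "Re (cinner (loc_op \<tau> f) g) = Re (cinner (loc_op \<tau> g) f)" by (metis cnj.sel(1))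
  then show ?thesis by (simp add: Re_cinner inner_commute)
qed

text \<open>Testing the weak integral against its own value gives a factor \<open>norm ?z\<close> on
  both sides, which cancels. Having the energy \<open>J\<close> here in place of
  \<open>norm f\<close> is what the trace estimate and the Landweber remainder need.\<close>

lemma norm_loc_op_le_energy:
  assumes \<tau>: "symbol_bounded \<tau> s"
    and J: "(\<integral>\<^sup>+p. ennreal ((\<tau> p * cmod (cinner f (v p)))\<^sup>2) \<partial>M) \<le> ennreal J" "0 \<le> J"
  shows "(norm (loc_op \<tau> f))\<^sup>2 \<le> C * J"
proof -
  let ?z = "loc_op \<tau> f"
  have "ennreal ((norm ?z)\<^sup>2) = ennreal (cmod (cinner ?z ?z))" by (simp add: cinner_self norm_power)
  also have "\<dots> \<le> ennreal (sqrt (J * C) * norm ?z)"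
    by (rule order_trans[OF norm_has_bochner_integral_le[OF loc_op_weak[OF \<tau>]]
        pairing_cauchy_schwarz[OF symbol_bounded_measurable[OF \<tau>] J]])
  finally have "norm ?z * norm ?z \<le> sqrt (J * C) * norm ?z"
    using J C_pos by (simp add: power2_eq_square)
  then have "norm ?z \<le> sqrt (J * C)"
    by (cases "norm ?z = 0") (use J C_pos in \<open>auto simp: mult_le_cancel_right\<close>)
  then have "(norm ?z)\<^sup>2 \<le> (sqrt (J * C))\<^sup>2" by (rule power_mono) simp
  then show ?thesis using J C_pos by (simp add: mult.commute)
qed

lemma norm_loc_op_le:
  assumes \<tau>: "symbol_bounded \<tau> s"
  shows "norm (loc_op \<tau> f) \<le> s * C * norm f"
proof (rule power2_le_imp_le)
  show "(norm (loc_op \<tau> f))\<^sup>2 \<le> (s * C * norm f)\<^sup>2"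
  proof -
    have "0 \<le> s\<^sup>2 * (C * (norm f)\<^sup>2)" using C_pos by simp
    from norm_loc_op_le_energy[OF \<tau> symbol_energy_le'[OF \<tau>] this]
    show ?thesis by (simp add: power_mult_distrib power2_eq_square mult_ac)
  qed
  show "0 \<le> s * C * norm f" using \<tau> C_pos by (simp add: symbol_bounded_def)
qed

lemma bounded_linear_loc_op:
  assumes "symbol_bounded \<tau> s"
  shows "bounded_linear (loc_op \<tau>)"
  by (rule bounded_linear_intro[where K = "s * C"])
     (use assms norm_loc_op_le[OF assms] in \<open>auto simp: loc_op_add loc_op_scaleR mult.commute\<close>)

lemma symbol_bounded_one: "symbol_bounded (\<lambda>_. 1) 1"
  by (simp add: symbol_bounded_def)

lemma symbol_bounded_indicator: "K \<in> sets M \<Longrightarrow> symbol_bounded (indicator K) 1"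
  by (auto simp: symbol_bounded_def indicator_def)

section \<open>The frame operator and its energy form\<close>

abbreviation frame_op :: "'a L2 \<Rightarrow> 'a L2" where
  "frame_op \<equiv> loc_op (\<lambda>_. 1)"

lemma frame_op_energy: "(\<integral>\<^sup>+p. ennreal ((cmod (cinner f (v p)))\<^sup>2) \<partial>M) = ennreal (inner (frame_op f) f)"
  and frame_op_nonneg: "0 \<le> inner (frame_op f) f"
proof -
  have eq: "cinner f (v p) * cinner (v p) f = of_real ((cmod (cinner f (v p)))\<^sup>2)" for p
    by (subst (2) cinner_commute) (simp only: complex_norm_square)
  have "has_bochner_integral M (\<lambda>p. complex_of_real ((cmod (cinner f (v p)))\<^sup>2)) (cinner (frame_op f) f)"
    using loc_op_weak[OF symbol_bounded_one, of f f] by (simp add: eq)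
  then have "has_bochner_integral M (\<lambda>p. Re (complex_of_real ((cmod (cinner f (v p)))\<^sup>2))) (Re (cinner (frame_op f) f))"
    by (rule has_bochner_integral_Re)
  then have *: "has_bochner_integral M (\<lambda>p. (cmod (cinner f (v p)))\<^sup>2) (inner (frame_op f) f)"
    by (simp add: Re_cinner)
  then show "(\<integral>\<^sup>+p. ennreal ((cmod (cinner f (v p)))\<^sup>2) \<partial>M) = ennreal (inner (frame_op f) f)"
    by (auto simp: has_bochner_integral_iff nn_integral_eq_integral)
  show "0 \<le> inner (frame_op f) f"
    unfolding has_bochner_integral_integral_eq[OF *, symmetric] by simp
qed

section \<open>Compactness for indicators of sets of finite measure\<close>

lemma sum_cmod_cinner_le:
  fixes x :: "'a L2"
  assumes "finite E" "pairwise orthogonal E" "\<And>e. e \<in> E \<Longrightarrow> norm e = 1"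
  shows "(\<Sum>e\<in>E. (cmod (cinner e x))\<^sup>2) \<le> 2 * (norm x)\<^sup>2"
proof -
  \<comment> \<open>\<open>E\<close> is orthonormal only for the real inner product and may contain
    both \<open>e\<close> and its multiple by \<i>. The real Bessel inequality is therefore used
    twice, for \<open>x\<close> and for \<open>scaleC \<i> x\<close>, which costs the factor
    2.\<close>
  have "(cmod (cinner e x))\<^sup>2 = (inner e x)\<^sup>2 + (inner e (scaleC \<i> x))\<^sup>2" for e
    by (simp add: cmod_power2 cinner_scaleC_right flip: Re_cinner)
  then have "(\<Sum>e\<in>E. (cmod (cinner e x))\<^sup>2) = (\<Sum>e\<in>E. (inner e x)\<^sup>2) + (\<Sum>e\<in>E. (inner e (scaleC \<i> x))\<^sup>2)"
    by (simp add: sum.distrib)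
  also have "\<dots> \<le> (norm x)\<^sup>2 + (norm (scaleC \<i> x))\<^sup>2"
    by (intro add_mono bessel_inequality_finite assms)
  finally show ?thesis by (simp add: norm_scaleC)
qed

text \<open>Up to constants the sum of the squared norms over an orthonormal set is a trace, which is at
  most the integral of \<open>norm (v p) ^ 2\<close> over \<open>K\<close>.\<close>

lemma small_off_finite_indicator:
  assumes K [measurable]: "K \<in> sets M" and fin: "emeasure M K < \<infinity>"
  shows "small_off_finite (loc_op (indicator K))"
proof (rule small_off_finite_if_sums_bounded)
  note ind = symbol_bounded_indicator[OF K]
  show "loc_op (indicator K) (r *\<^sub>R x) = r *\<^sub>R loc_op (indicator K) x" for r x
    by (rule loc_op_scaleR[OF ind])
  fix E :: "'a L2 set"
  assume E: "finite E" "pairwise orthogonal E" "\<And>e. e \<in> E \<Longrightarrow> norm e = 1"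
  define J where "J e = (\<integral>\<^sup>+p. ennreal ((indicator K p * cmod (cinner e (v p)))\<^sup>2) \<partial>M)" for e
  have J_fin: "ennreal (enn2real (J e)) = J e" for e
    using symbol_energy_le'[OF ind, of e] unfolding J_def[symmetric]
    by (intro ennreal_enn2real) (auto intro: le_less_trans)
  have "(\<Sum>e\<in>E. (norm (loc_op (indicator K) e))\<^sup>2) \<le> (\<Sum>e\<in>E. C * enn2real (J e))"
    by (intro sum_mono norm_loc_op_le_energy[OF ind]) (simp_all add: J_fin flip: J_def)
  also have "\<dots> = C * (\<Sum>e\<in>E. enn2real (J e))" by (simp add: sum_distrib_left)
  also have "(\<Sum>e\<in>E. enn2real (J e)) \<le> 2 * c\<^sup>2 * measure M K"
  proof -
    have "ennreal (\<Sum>e\<in>E. enn2real (J e)) = (\<Sum>e\<in>E. J e)"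
      by (subst sum_ennreal[symmetric]) (simp_all add: J_fin)
    also have "\<dots> = (\<integral>\<^sup>+p. (\<Sum>e\<in>E. ennreal ((indicator K p * cmod (cinner e (v p)))\<^sup>2)) \<partial>M)"
      unfolding J_def by (subst nn_integral_sum) auto
    also have "\<dots> \<le> (\<integral>\<^sup>+p. ennreal (2 * c\<^sup>2) * indicator K p \<partial>M)"
    proof (rule nn_integral_mono)
      fix p assume p: "p \<in> space M"
      have "(\<Sum>e\<in>E. (cmod (cinner e (v p)))\<^sup>2) \<le> 2 * (norm (v p))\<^sup>2"
        by (rule sum_cmod_cinner_le[OF E])
      also have "\<dots> \<le> 2 * c\<^sup>2" using v_bound[OF p] by (simp add: power_mono)
      finally have "ennreal (\<Sum>e\<in>E. (cmod (cinner e (v p)))\<^sup>2) \<le> ennreal (2 * c\<^sup>2)" by (rule ennreal_leI)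
      then show "(\<Sum>e\<in>E. ennreal ((indicator K p * cmod (cinner e (v p)))\<^sup>2))
          \<le> ennreal (2 * c\<^sup>2) * indicator K p"
        by (auto simp: indicator_def sum_ennreal)
    qed
    also have "\<dots> = ennreal (2 * c\<^sup>2 * measure M K)"
      using fin by (simp add: nn_integral_cmult_indicator emeasure_eq_ennreal_measure ennreal_mult[symmetric])
    finally show ?thesis by (subst (asm) ennreal_le_iff) auto
  qed
  finally show "(\<Sum>e\<in>E. (norm (loc_op (indicator K) e))\<^sup>2) \<le> C * (2 * c\<^sup>2 * measure M K)"
    using C_pos by simp
qed

text \<open>Only the rows outside \<open>K\<close> are small; for the columns there is merely the
  bound \<open>s * C\<close>. Schur's test tolerates this, since its norm bound is governed by the
  product of the row and column constants.\<close>

lemma norm_loc_op_tail_le: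
  assumes \<sigma>: "symbol_bounded \<sigma> s" and K [measurable]: "K \<in> sets M" and \<delta>: "0 \<le> \<delta>"
    and rows: "\<And>p. p \<in> space M - K \<Longrightarrow>
      (\<integral>\<^sup>+q. ennreal (\<bar>\<sigma> q\<bar> * cmod (cinner (v p) (v q)) * w q) \<partial>M) \<le> ennreal (\<delta> * w p)"
  shows "(norm (loc_op \<sigma> (loc_op (indicator (space M - K)) f)))\<^sup>2 \<le> s * \<delta> * C ^ 3 * (norm f)\<^sup>2"
proof -
  have [measurable]: "\<sigma> \<in> borel_measurable M" using \<sigma> by (rule symbol_bounded_measurable)
  have s: "0 < s" "AE q in M. \<bar>\<sigma> q\<bar> \<le> s" using \<sigma> by (auto simp: symbol_bounded_def)
  define x where "x p = indicator (space M - K) p * cmod (cinner f (v p))" for p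
  have [measurable]: "x \<in> borel_measurable M" unfolding x_def by measurable
  have "space M - K \<in> sets M" by simp
  note ind = symbol_bounded_indicator[OF this]
  define y where "y = loc_op (indicator (space M - K)) f"
  define z where "z = loc_op \<sigma> y"
  \<comment> \<open>With this balance the term in \<open>norm z\<close> on the right of Schur's test
    is exactly half of the left-hand side and can be absorbed.\<close>
  define t where "t = s * C\<^sup>2"
  have t: "0 < t" using s C_pos by (simp add: t_def)
  have yq: "ennreal (cmod (cinner y (v q))) \<le> (\<integral>\<^sup>+p. ennreal (x p * cmod (cinner (v p) (v q))) \<partial>M)" for q
    using norm_has_bochner_integral_le[OF loc_op_weak[OF ind, of f "v q"]]
    by (simp add: norm_mult x_def y_def)
  have "ennreal ((norm z)\<^sup>2) = ennreal (cmod (cinner z z))"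
    by (simp add: cinner_self norm_power)
  also have "\<dots> \<le> (\<integral>\<^sup>+q. ennreal (cmod (complex_of_real (\<sigma> q) * cinner y (v q) * cinner (v q) z)) \<partial>M)"
    using norm_has_bochner_integral_le[OF loc_op_weak[OF \<sigma>, of y z]] by (simp add: z_def)
  also have "\<dots> = (\<integral>\<^sup>+q. ennreal (\<bar>\<sigma> q\<bar> * cmod (cinner z (v q))) * ennreal (cmod (cinner y (v q))) \<partial>M)"
    by (simp add: norm_mult ennreal_mult cmod_cinner_commute[of z] mult_ac)
  also have "\<dots> \<le> (\<integral>\<^sup>+q. ennreal (\<bar>\<sigma> q\<bar> * cmod (cinner z (v q)))
      * (\<integral>\<^sup>+p. ennreal (x p * cmod (cinner (v p) (v q))) \<partial>M) \<partial>M)"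
    by (intro nn_integral_mono mult_left_mono yq) simp
  also have "\<dots> = (\<integral>\<^sup>+q. \<integral>\<^sup>+p. ennreal (\<bar>x p\<bar> * \<bar>\<sigma> q\<bar> * cmod (cinner (v p) (v q))
      * \<bar>cmod (cinner z (v q))\<bar>) \<partial>M \<partial>M)"
    by (intro nn_integral_cong, subst nn_integral_cmult[symmetric])
       (auto simp: ennreal_mult[symmetric] mult_ac x_def)
  also have "\<dots> \<le> ennreal (t * \<delta> / 2) * (\<integral>\<^sup>+p. ennreal ((x p)\<^sup>2) \<partial>M)
      + ennreal (s * C / (2 * t)) * (\<integral>\<^sup>+p. ennreal ((cmod (cinner z (v p)))\<^sup>2) \<partial>M)"
    by (rule schur_bilinear)
       (use s \<delta> t rows in \<open>auto simp: x_def indicator_def split: if_splits\<close>)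
  also have "\<dots> \<le> ennreal (t * \<delta> / 2) * ennreal (C * (norm f)\<^sup>2)
      + ennreal (s * C / (2 * t)) * ennreal (C * (norm z)\<^sup>2)"
  proof (intro add_mono mult_left_mono bessel)
    show "(\<integral>\<^sup>+p. ennreal ((x p)\<^sup>2) \<partial>M) \<le> ennreal (C * (norm f)\<^sup>2)"
      using symbol_energy_le'[OF ind, of f] by (simp add: x_def)
  qed auto
  also have "\<dots> = ennreal (t * \<delta> / 2 * (C * (norm f)\<^sup>2) + s * C / (2 * t) * (C * (norm z)\<^sup>2))"
    using s \<delta> t C_pos by (simp add: ennreal_mult[symmetric] ennreal_plus[symmetric] del: ennreal_plus)
  finally have "(norm z)\<^sup>2 \<le> t * \<delta> / 2 * (C * (norm f)\<^sup>2) + s * C / (2 * t) * (C * (norm z)\<^sup>2)"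
    using s \<delta> t C_pos by (subst (asm) ennreal_le_iff) auto
  also have "s * C / (2 * t) * (C * (norm z)\<^sup>2) = (norm z)\<^sup>2 / 2"
    using s C_pos by (simp add: t_def power2_eq_square)
  finally have "(norm z)\<^sup>2 \<le> t * \<delta> * (C * (norm f)\<^sup>2)" by simp
  then show ?thesis by (simp add: z_def y_def t_def power2_eq_square power3_eq_cube mult_ac)
qed

section \<open>Landweber iteration\<close>

definition landweber :: "'a L2 \<Rightarrow> 'a L2" where
  "landweber g = g - frame_op g /\<^sub>R C"

text \<open>The sum telescopes. Each of its terms passes through \<open>frame_op\<close>, so after
  composition with \<open>loc_op \<sigma>\<close> only the image of the remainder
  \<open>(landweber ^^ n) g\<close> is left to estimate.\<close>

lemma landweber_pow_sum: "g - (landweber ^^ n) g = (\<Sum>k<n. frame_op ((landweber ^^ k) g) /\<^sub>R C)"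
  by (induction n) (simp_all add: landweber_def algebra_simps)

lemma landweber_symmetric: "inner (landweber f) g = inner f (landweber g)"
  by (simp add: landweber_def inner_diff_left inner_diff_right loc_op_symmetric[OF symbol_bounded_one])

lemma norm_frame_op_le: "(norm (frame_op g))\<^sup>2 \<le> C * inner (frame_op g) g"
  by (rule norm_loc_op_le_energy[OF symbol_bounded_one]) (simp_all add: frame_op_energy frame_op_nonneg)

text \<open>In the expanded square the cross term gains twice the energy over \<open>C\<close>, and
  by \<open>norm_frame_op_le\<close> the quadratic term gives back at most half of that
  gain.\<close>

lemma norm_landweber_le: "(norm (landweber g))\<^sup>2 \<le> (norm g)\<^sup>2 - inner (frame_op g) g / C"
proof -
  have "(norm (landweber g))\<^sup>2 = (norm g)\<^sup>2 - 2 * inner (frame_op g) g / C + (norm (frame_op g))\<^sup>2 / C\<^sup>2"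
    unfolding landweber_def power2_norm_eq_inner
    using C_pos by (simp add: inner_diff_left inner_diff_right inner_commute[of g "frame_op g"] power2_eq_square field_simps)
  also have "(norm (frame_op g))\<^sup>2 / C\<^sup>2 \<le> C * inner (frame_op g) g / C\<^sup>2"
    by (intro divide_right_mono norm_frame_op_le) simp
  also have "\<dots> = inner (frame_op g) g / C" using C_pos by (simp add: power2_eq_square)
  finally show ?thesis by (simp add: field_simps)
qed

lemma norm_landweber_le': "norm (landweber g) \<le> norm g"
proof (rule power2_le_imp_le)
  have "0 \<le> inner (frame_op g) g / C" using frame_op_nonneg C_pos by simp
  then show "(norm (landweber g))\<^sup>2 \<le> (norm g)\<^sup>2" using norm_landweber_le[of g] by linarith
qed simp

lemma landweber_pow_symmetric: "inner ((landweber ^^ n) f) g = inner f ((landweber ^^ n) g)"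
  by (induction n arbitrary: f) (simp_all add: landweber_symmetric funpow_swap1)

lemma norm_landweber_pow_le: "norm ((landweber ^^ n) g) \<le> norm g"
  by (induction n) (auto intro: order_trans[OF norm_landweber_le'])

text \<open>With \<open>h = frame_op g\<close> the new energy is the old one minus
  \<open>2 * inner h h / C\<close> plus \<open>inner (frame_op h) h / C\<^sup>2\<close>; the
  operator norm bound \<open>C\<close> makes the last term at most
  \<open>inner h h / C\<close>.\<close>

lemma energy_landweber_le: "inner (frame_op (landweber g)) (landweber g) \<le> inner (frame_op g) g"
proof -
  define h where "h = frame_op g"
  have lin: "frame_op (landweber g) = h - frame_op h /\<^sub>R C"
    using bounded_linear_loc_op[OF symbol_bounded_one]
    by (simp add: landweber_def h_def linear_diff[OF bounded_linear.linear] linear_scale[OF bounded_linear.linear])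
  have "inner (frame_op h) h \<le> norm (frame_op h) * norm h" by (rule norm_cauchy_schwarz)
  also have "\<dots> \<le> C * norm h * norm h"
    using norm_loc_op_le[OF symbol_bounded_one, of h] by (intro mult_right_mono) auto
  finally have "inner (frame_op h) h \<le> C * inner h h"
    by (simp add: power2_norm_eq_inner[symmetric] power2_eq_square)
  then have "inner (frame_op h) h / C\<^sup>2 \<le> C * inner h h / C\<^sup>2" by (intro divide_right_mono) auto
  also have "\<dots> = inner h h / C" using C_pos by (simp add: power2_eq_square)
  finally have *: "inner (frame_op h) h / C\<^sup>2 \<le> inner h h / C" .
  have "inner (frame_op h) g = inner h h"
    unfolding h_def by (rule loc_op_symmetric[OF symbol_bounded_one])
  then have "inner (frame_op (landweber g)) (landweber g)
      = inner h g - 2 * inner h h / C + inner (frame_op h) h / C\<^sup>2"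
    unfolding lin unfolding landweber_def h_def[symmetric]
    using C_pos by (simp add: inner_diff_left inner_diff_right power2_eq_square field_simps)
  moreover have "0 \<le> inner h h / C" using C_pos by simp
  ultimately show ?thesis using * by (simp add: h_def)
qed

text \<open>Each energy is paid for by a drop of the squared norm, and these drops telescope. As the
  energies decrease, the last one is at most their average.\<close>

lemma energy_landweber_pow_le: "real n * inner (frame_op ((landweber ^^ n) g)) ((landweber ^^ n) g)
    \<le> C * (norm g)\<^sup>2"
proof -
  define e where "e k = inner (frame_op ((landweber ^^ k) g)) ((landweber ^^ k) g)" for k
  have "e n \<le> e k" if "k \<le> n" for k
    using that by (rule lift_Suc_antimono_le[rotated]) (simp add: e_def energy_landweber_le)
  then have "real n * e n \<le> (\<Sum>k<n. e k)" using sum_bounded_below[of "{..<n}" "e n" e] by simp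
  also have "\<dots> \<le> C * ((norm g)\<^sup>2 - (norm ((landweber ^^ n) g))\<^sup>2)"
  proof (induction n)
    case (Suc n)
    have "e n \<le> C * ((norm ((landweber ^^ n) g))\<^sup>2 - (norm ((landweber ^^ Suc n) g))\<^sup>2)"
      using norm_landweber_le[of "(landweber ^^ n) g"] C_pos by (simp add: e_def field_simps)
    with Suc show ?case by (simp add: algebra_simps)
  qed simp
  also have "\<dots> \<le> C * (norm g)\<^sup>2" using C_pos by (intro mult_left_mono) auto
  finally show ?thesis by (simp add: e_def)
qed

section \<open>Compactness of the localization operator\<close>

theorem small_off_finite_loc_op:
  assumes \<sigma>: "symbol_bounded \<sigma> s"
    and rows: "\<And>\<delta>. \<delta> > 0 \<Longrightarrow> \<exists>K\<in>sets M. emeasure M K < \<infinity> \<and> (\<forall>p\<in>space M - K.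
      (\<integral>\<^sup>+q. ennreal (\<bar>\<sigma> q\<bar> * cmod (cinner (v p) (v q)) * w q) \<partial>M) \<le> ennreal (\<delta> * w p))"
  shows "small_off_finite (loc_op \<sigma>)"
proof -
  have s: "0 < s" using \<sigma> by (simp add: symbol_bounded_def)
  interpret \<sigma>: bounded_linear "loc_op \<sigma>" by (rule bounded_linear_loc_op[OF \<sigma>])
  \<comment> \<open>First stage: compactness after composition with \<open>frame_op\<close>, by
    cutting its symbol off to \<open>K\<close>.\<close>
  have frame: "small_off_finite (\<lambda>g. loc_op \<sigma> (frame_op g))"
  proof (rule small_off_finite_approx)
    fix \<epsilon> :: real assume \<epsilon>: "\<epsilon> > 0"
    \<comment> \<open>Chosen so that the constant \<open>s * \<delta> * C ^ 3\<close> of the tail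
      estimate equals \<open>\<epsilon>\<^sup>2\<close>.\<close>
    define \<delta> where "\<delta> = \<epsilon>\<^sup>2 / (s * C ^ 3)"
    have \<delta>: "\<delta> > 0" using \<epsilon> s C_pos by (simp add: \<delta>_def)
    obtain K where K: "K \<in> sets M" "emeasure M K < \<infinity>" "\<And>p. p \<in> space M - K \<Longrightarrow>
        (\<integral>\<^sup>+q. ennreal (\<bar>\<sigma> q\<bar> * cmod (cinner (v p) (v q)) * w q) \<partial>M) \<le> ennreal (\<delta> * w p)"
      using rows[OF \<delta>] by blast
    let ?Kc = "space M - K"
    \<comment> \<open>The sum of the two indicators is 1 only on the space of \<open>M\<close>, so
      the operators are compared through their weak integrals instead of by rewriting the
      symbol.\<close>
    have one: "loc_op (\<lambda>p. indicator K p + indicator ?Kc p) g = frame_op g" for g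
    proof (rule sym, rule loc_op_eqI[OF symbol_bounded_one])
      fix h
      have "symbol_bounded (\<lambda>p. indicator K p + indicator ?Kc p) 2"
        using K(1) by (auto simp: symbol_bounded_def indicator_def)
      from loc_op_weak[OF this, of g h]
      show "has_bochner_integral M (\<lambda>p. complex_of_real 1 * cinner g (v p) * cinner (v p) h)
          (cinner (loc_op (\<lambda>p. indicator K p + indicator ?Kc p) g) h)"
        by (rule has_bochner_integral_cong[THEN iffD1, rotated -1]) (auto simp: indicator_def)
    qed
    have "symbol_bounded (\<lambda>p. indicator K p + indicator ?Kc p) 2"
      using K(1) by (auto simp: symbol_bounded_def indicator_def)
    then have split: "frame_op g = loc_op (indicator K) g + loc_op (indicator ?Kc) g" for g
      unfolding one[symmetric]
      using K(1) by (intro loc_op_add_symbol[where s = 1 and s' = 1] symbol_bounded_indicator) auto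
    have "norm (loc_op \<sigma> (frame_op g) - loc_op \<sigma> (loc_op (indicator K) g)) \<le> \<epsilon> * norm g" for g
    proof (rule power2_le_imp_le)
      have "(norm (loc_op \<sigma> (loc_op (indicator ?Kc) g)))\<^sup>2 \<le> s * \<delta> * C ^ 3 * (norm g)\<^sup>2"
        using \<delta> by (intro norm_loc_op_tail_le[OF \<sigma> K(1)] K(3)) auto
      then show "(norm (loc_op \<sigma> (frame_op g) - loc_op \<sigma> (loc_op (indicator K) g)))\<^sup>2 \<le> (\<epsilon> * norm g)\<^sup>2"
        using s C_pos by (simp add: split \<sigma>.add \<delta>_def power_mult_distrib)
    qed (use \<epsilon> in simp)
    moreover have "small_off_finite (\<lambda>g. loc_op \<sigma> (loc_op (indicator K) g))"
      by (rule small_off_finite_compose_left[OF small_off_finite_indicator[OF K(1,2)] norm_loc_op_le[OF \<sigma>]])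
    ultimately show "\<exists>S. small_off_finite S \<and> (\<forall>g. norm (loc_op \<sigma> (frame_op g) - S g) \<le> \<epsilon> * norm g)"
      by blast
  qed
  show ?thesis
  proof (rule small_off_finite_approx)
    fix \<epsilon> :: real assume \<epsilon>: "\<epsilon> > 0"
    \<comment> \<open>Large enough to bring the constant \<open>(C * s)\<^sup>2 / n\<close> of the
      remainder below \<open>\<epsilon>\<^sup>2\<close>.\<close>
    obtain n where n: "(C * s)\<^sup>2 / \<epsilon>\<^sup>2 < real n" using reals_Archimedean2 by blast
    then have n0: "0 < real n" by (rule le_less_trans[rotated]) simp
    define S where "S g = (\<Sum>k<n. loc_op \<sigma> (frame_op ((landweber ^^ k) g)) /\<^sub>R C)" for g
    have "small_off_finite (\<lambda>g. loc_op \<sigma> (frame_op ((landweber ^^ k) g)))" for k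
      by (rule small_off_finite_compose_right[OF frame, where K = 1])
         (simp_all add: norm_landweber_pow_le landweber_pow_symmetric)
    then have "small_off_finite S"
      unfolding S_def
      by (intro small_off_finite_sum small_off_finite_compose_left[where B = "\<lambda>x. x /\<^sub>R C" and K = "\<bar>1 / C\<bar>"])
         (auto simp: field_simps)
    moreover have "norm (loc_op \<sigma> g - S g) \<le> \<epsilon> * norm g" for g
    proof (rule power2_le_imp_le)
      let ?r = "(landweber ^^ n) g"
      have "loc_op \<sigma> g - loc_op \<sigma> ?r = S g"
        by (simp add: \<sigma>.diff[symmetric] landweber_pow_sum \<sigma>.sum \<sigma>.scaleR S_def)
      then have "loc_op \<sigma> g - S g = loc_op \<sigma> ?r" by (simp add: algebra_simps)
      then have "(norm (loc_op \<sigma> g - S g))\<^sup>2 = (norm (loc_op \<sigma> ?r))\<^sup>2" by simp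
      \<comment> \<open>It is the energy of \<open>?r\<close> that is uniformly small;
        \<open>?r\<close> itself need not tend to 0 in operator norm.\<close>
      also have "\<dots> \<le> C * (s\<^sup>2 * inner (frame_op ?r) ?r)"
        using symbol_energy_le[OF \<sigma>, of ?r] frame_op_nonneg
        by (intro norm_loc_op_le_energy[OF \<sigma>]) (simp_all add: frame_op_energy ennreal_mult[symmetric])
      also have "\<dots> \<le> C * (s\<^sup>2 * (C * (norm g)\<^sup>2 / n))"
        using energy_landweber_pow_le[of n g] n0 C_pos
        by (intro mult_left_mono) (auto simp: field_simps)
      also have "\<dots> = (C * s)\<^sup>2 / n * (norm g)\<^sup>2"
        by (simp add: power2_eq_square)
      also have "\<dots> \<le> \<epsilon>\<^sup>2 * (norm g)\<^sup>2"
        using n n0 \<epsilon> by (intro mult_right_mono) (auto simp: field_simps)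
      finally show "(norm (loc_op \<sigma> g - S g))\<^sup>2 \<le> (\<epsilon> * norm g)\<^sup>2"
        by (simp add: power_mult_distrib)
    qed (use \<epsilon> in simp)
    ultimately show "\<exists>S. small_off_finite S \<and> (\<forall>g. norm (loc_op \<sigma> g - S g) \<le> \<epsilon> * norm g)" by blast
  qed
qed

corollary compact_operator_loc_op:
  assumes "symbol_bounded \<sigma> s"
    and "\<And>\<delta>. \<delta> > 0 \<Longrightarrow> \<exists>K\<in>sets M. emeasure M K < \<infinity> \<and> (\<forall>p\<in>space M - K.
      (\<integral>\<^sup>+q. ennreal (\<bar>\<sigma> q\<bar> * cmod (cinner (v p) (v q)) * w q) \<partial>M) \<le> ennreal (\<delta> * w p))"
  shows "compact_operator (loc_op \<sigma>)"
  unfolding compact_operator_def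
  using bounded_linear_loc_op[OF assms(1)] loc_op_scaleC[OF assms(1)]
    compact_closure_image_ball[OF bounded_linear_loc_op[OF assms(1)] small_off_finite_loc_op[OF assms]]
  by blast

end

section \<open>Haar measure of the affine group\<close>

lemma affine_group_iff: "p \<in> affine_group \<longleftrightarrow> 0 < fst p"
  by (cases p) (simp add: affine_group_def)

lemma affine_group_sets [measurable]: "affine_group \<in> sets borel"
  unfolding affine_group_def by (intro borel_open open_Times) auto

lemma space_affine_haar [simp]: "space affine_haar = affine_group"
  by (simp add: affine_haar_def space_restrict_space)

lemma sets_affine_haar [measurable_cong]: "sets affine_haar = sets (restrict_space borel affine_group)"
  by (simp add: affine_haar_def sets_restrict_space)

lemma in_sets_affine_haar: "A \<in> sets affine_haar \<longleftrightarrow> A \<subseteq> affine_group \<and> A \<in> sets borel"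
  by (auto simp: sets_affine_haar sets_restrict_space_iff)

lemma measurable_affine_haarI:
  "f \<in> measurable borel N \<Longrightarrow> f \<in> measurable affine_haar N"
  by (simp add: measurable_cong_sets[OF sets_affine_haar refl] measurable_restrict_space1)

lemma measurable_affine_haar_ident [measurable]: "(\<lambda>p. p) \<in> measurable affine_haar borel"
  by (rule measurable_affine_haarI) simp

lemma borel_measurable_affine_haar_iff:
  fixes F :: "_ \<Rightarrow> ennreal"
  shows "F \<in> borel_measurable affine_haar \<longleftrightarrow> (\<lambda>p. F p
      * indicator affine_group p) \<in> borel_measurable borel"
  by (simp add: measurable_cong_sets[OF sets_affine_haar refl] borel_measurable_restrict_space_iff_ennreal)

lemma nn_integral_affine_haar:
  fixes F :: "real \<times> 'a::euclidean_space \<Rightarrow> ennreal"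
  assumes F: "F \<in> borel_measurable affine_haar"
  shows "(\<integral>\<^sup>+p. F p \<partial>affine_haar)
    = (\<integral>\<^sup>+p. F p * indicator affine_group p * ennreal (1 / fst p) \<partial>lborel)"
proof -
  have F': "F \<in> borel_measurable (restrict_space lborel affine_group)"
    using F by (simp add: affine_haar_def)
  have "(\<lambda>p::real \<times> 'a. ennreal (1 / fst p)) \<in> borel_measurable (restrict_space lborel affine_group)"
    by (intro measurable_restrict_space1) (simp add: borel_prod[symmetric])
  then have "(\<integral>\<^sup>+p. F p \<partial>affine_haar)
      = (\<integral>\<^sup>+p. ennreal (1 / fst p) * F p \<partial>restrict_space lborel affine_group)"
    unfolding affine_haar_def using F' by (rule nn_integral_density)
  also have "\<dots> = (\<integral>\<^sup>+p. ennreal (1 / fst p) * F p * indicator affine_group p \<partial>lborel)"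
    by (rule nn_integral_restrict_space) simp
  finally show ?thesis by (simp add: mult_ac)
qed

lemma nn_integral_affine_haar_iterated:
  fixes F :: "real \<times> 'a::euclidean_space \<Rightarrow> ennreal"
  assumes F: "F \<in> borel_measurable affine_haar"
  shows "(\<integral>\<^sup>+p. F p \<partial>affine_haar)
    = (\<integral>\<^sup>+a. (\<integral>\<^sup>+b. F (a, b) * indicator affine_group (a, b) \<partial>lborel) * ennreal (1 / a) \<partial>lborel)"
proof -
  have [measurable]: "(\<lambda>p. F p * indicator affine_group p) \<in> borel_measurable (borel \<Otimes>\<^sub>M borel)"
    using F by (simp add: borel_measurable_affine_haar_iff borel_prod)
  have "(\<integral>\<^sup>+p. F p \<partial>affine_haar)
      = (\<integral>\<^sup>+p. F p * indicator affine_group p * ennreal (1 / fst p) \<partial>(lborel \<Otimes>\<^sub>M lborel))"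
    by (simp add: nn_integral_affine_haar[OF F] lborel_prod)
  also have "\<dots> = (\<integral>\<^sup>+a. \<integral>\<^sup>+b. F (a, b) * indicator affine_group (a, b)
      * ennreal (1 / a) \<partial>lborel \<partial>lborel)"
    by (subst lborel.nn_integral_fst[symmetric]) simp_all
  also have "\<dots> = (\<integral>\<^sup>+a. (\<integral>\<^sup>+b. F (a, b) * indicator affine_group (a, b) \<partial>lborel)
      * ennreal (1 / a) \<partial>lborel)"
    by (intro nn_integral_cong nn_integral_multc) measurable
  finally show ?thesis .
qed

section \<open>Left translations\<close>

lemma affine_mult_in_group: "p \<in> affine_group \<Longrightarrow> affine_mult p q \<in> affine_group \<longleftrightarrow> q \<in> affine_group"
  by (auto simp: affine_group_iff affine_mult_def zero_less_mult_iff)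

lemma affine_mult_one: "affine_mult p (1, 0) = p"
  by (simp add: affine_mult_def)

lemma borel_measurable_affine_mult [measurable]: "affine_mult p \<in> borel_measurable borel"
  unfolding affine_mult_def[abs_def] borel_prod[symmetric] by measurable

lemma measurable_affine_mult: "p \<in> affine_group \<Longrightarrow> affine_mult p \<in> measurable affine_haar affine_haar"
  unfolding measurable_cong_sets[OF sets_affine_haar sets_affine_haar]
  by (rule measurable_restrict_space3) (auto simp: affine_mult_in_group)

text \<open>Left multiplication scales the first coordinate and shifts the second by an amount that
  depends on the first coordinate alone. For a fixed first coordinate the shift leaves the inner
  integral unchanged, and the outer measure \<open>da / a\<close> is invariant under
  scaling.\<close>

lemma nn_integral_affine_haar_left_invariant:
  fixes F :: "real \<times> 'a::euclidean_space \<Rightarrow> ennreal"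
  assumes F: "F \<in> borel_measurable affine_haar" and p: "p \<in> affine_group"
  shows "(\<integral>\<^sup>+q. F (affine_mult p q) \<partial>affine_haar) = (\<integral>\<^sup>+q. F q \<partial>affine_haar)"
proof -
  define G where "G q = F q * indicator affine_group q" for q
  have G [measurable]: "G \<in> borel_measurable borel"
    using F by (simp add: G_def[abs_def] borel_measurable_affine_haar_iff)
  have G': "(\<lambda>(a, b). G (a, b)) \<in> borel_measurable (borel \<Otimes>\<^sub>M borel)" by (simp add: borel_prod)
  have a: "0 < fst p" using p by (simp add: affine_group_iff)
  define I where "I a = (\<integral>\<^sup>+b. G (a, b) \<partial>lborel)" for a
  have I [measurable]: "I \<in> borel_measurable borel" unfolding I_def by measurable
  have inner: "(\<integral>\<^sup>+b. F (affine_mult p (a, b)) * indicator affine_group (a, b) \<partial>lborel)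
      = I (fst p * a)" for a
  proof -
    have "I (fst p * a) = (\<integral>\<^sup>+b. G (fst p * a, b) \<partial>distr lborel borel ((+) (snd p /\<^sub>R a)))"
      by (simp add: I_def lborel_distr_plus)
    also have "\<dots> = (\<integral>\<^sup>+b. G (affine_mult p (a, b)) \<partial>lborel)"
      by (subst nn_integral_distr) (auto simp: affine_mult_def)
    finally show ?thesis
      using p by (simp add: G_def indicator_def affine_mult_in_group)
  qed
  have "(\<integral>\<^sup>+q. F (affine_mult p q) \<partial>affine_haar) = (\<integral>\<^sup>+a. I (fst p * a) * ennreal (1 / a) \<partial>lborel)"
    unfolding nn_integral_affine_haar_iterated[OF measurable_compose[OF measurable_affine_mult[OF p] F]]
    by (simp add: inner)
  also have "\<dots> = (\<integral>\<^sup>+a. ennreal (fst p) * (I (fst p * a) * ennreal (1 / (fst p * a))) \<partial>lborel)"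
  proof (intro nn_integral_cong)
    fix x :: real
    \<comment> \<open>For \<open>x \<le> 0\<close> both sides are 0, with 1 / 0 = 0 at the
      origin.\<close>
    have "ennreal (1 / x) = ennreal (fst p) * ennreal (1 / (fst p * x))"
      using a by (subst ennreal_mult'[symmetric]) auto
    then show "I (fst p * x) * ennreal (1 / x)
        = ennreal (fst p) * (I (fst p * x) * ennreal (1 / (fst p * x)))"
      by (simp add: mult_ac)
  qed
  also have "\<dots> = ennreal \<bar>fst p\<bar> * (\<integral>\<^sup>+a. I (0 + fst p * a) * ennreal (1 / (0 + fst p * a)) \<partial>lborel)"
    using a by (subst nn_integral_cmult) auto
  also have "\<dots> = (\<integral>\<^sup>+a. I a * ennreal (1 / a) \<partial>lborel)"
    using a by (intro nn_integral_real_affine[symmetric]) auto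
  also have "\<dots> = (\<integral>\<^sup>+q. F q \<partial>affine_haar)"
    by (simp add: nn_integral_affine_haar_iterated[OF F] I_def G_def)
  finally show ?thesis .
qed

section \<open>Sets of finite Haar measure and neighbourhoods of infinity\<close>

lemma emeasure_affine_haar_finite:
  fixes A :: "(real \<times> 'a::euclidean_space) set"
  assumes A: "A \<in> sets borel" "bounded A" and r: "0 < r" "\<And>p. p \<in> A \<Longrightarrow> r \<le> fst p"
  shows "A \<in> sets affine_haar" "emeasure affine_haar A < \<infinity>"
proof -
  have sub: "A \<subseteq> affine_group" using r by (force simp: affine_group_iff)
  then show A': "A \<in> sets affine_haar" using A by (simp add: in_sets_affine_haar)
  have "emeasure affine_haar A = (\<integral>\<^sup>+p. indicator A p \<partial>affine_haar)" using A' by simp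
  also have "\<dots> = (\<integral>\<^sup>+p. indicator A p * indicator affine_group p * ennreal (1 / fst p) \<partial>lborel)"
    using A' by (intro nn_integral_affine_haar) simp
  also have "\<dots> \<le> (\<integral>\<^sup>+p. ennreal (1 / r) * indicator A p \<partial>lborel)"
  proof (rule nn_integral_mono)
    fix p show "indicator A p * indicator affine_group p * ennreal (1 / fst p)
        \<le> ennreal (1 / r) * indicator A p"
    proof (cases "p \<in> A")
      case True
      have "1 / fst p \<le> 1 / r" using r(1) r(2)[OF True] by (intro frac_le) auto
      then show ?thesis using True by (auto simp: indicator_def intro: ennreal_leI)
    qed simp
  qed
  also have "\<dots> = ennreal (1 / r) * emeasure lborel A"
    using A by (intro nn_integral_cmult_indicator) simp
  also have "\<dots> < \<infinity>"
    using emeasure_bounded_finite[OF A(2)] by (simp add: ennreal_mult_less_top)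
  finally show "emeasure affine_haar A < \<infinity>" .
qed

lemma sigma_finite_affine_haar: "sigma_finite_measure (affine_haar :: (real \<times> 'a::euclidean_space) measure)"
proof
  let ?A = "\<lambda>n::nat. {p::real \<times> 'a. norm p \<le> real n \<and> 1 / real (Suc n) \<le> fst p}"
  have "?A n \<in> sets borel" for n
    by (intro borel_closed closed_Collect_conj closed_Collect_le continuous_intros)
  moreover have "bounded (?A n)" for n by (rule boundedI[of _ "real n"]) auto
  ultimately have *: "?A n \<in> sets affine_haar" "emeasure affine_haar (?A n) < \<infinity>" for n
    using emeasure_affine_haar_finite[of "?A n" "1 / real (Suc n)"] by auto
  have "p \<in> (\<Union>n. ?A n)" if p: "p \<in> affine_group" for p
  proof -
    obtain n where "norm p + 1 / fst p < real n" using reals_Archimedean2 by blast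
    moreover have "0 < fst p" "0 < 1 / fst p" "0 \<le> norm p" using p by (auto simp: affine_group_iff)
    ultimately have "norm p \<le> real n" "1 / fst p \<le> real (Suc n)" by linarith+
    then have "p \<in> ?A n" using \<open>0 < fst p\<close> by (simp add: field_simps)
    then show ?thesis by blast
  qed
  moreover have "?A n \<subseteq> affine_group" for n
    using *(1)[of n] by (simp add: in_sets_affine_haar)
  ultimately show "\<exists>A. countable A \<and> A \<subseteq> sets affine_haar \<and> \<Union> A = space affine_haar \<and>
      (\<forall>a\<in>A. emeasure (affine_haar :: (real \<times> 'a) measure) a \<noteq> \<infinity>)"
    using * by (intro exI[of _ "range ?A"]) (auto simp: less_top[symmetric])
qed

text \<open>The first coordinate attains a positive minimum on a nonempty \<open>K\<close>, which
  keeps the density of the Haar measure bounded there.\<close>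

lemma emeasure_affine_haar_compact:
  fixes K :: "(real \<times> 'a::euclidean_space) set"
  assumes K: "compact K" "K \<subseteq> affine_group"
  shows "K \<in> sets affine_haar" "emeasure affine_haar K < \<infinity>"
proof -
  have "\<exists>r>0. \<forall>p\<in>K. r \<le> fst p"
  proof (cases "K = {}")
    case False
    have "continuous_on K fst" by (intro continuous_intros)
    from continuous_attains_inf[OF K(1) False this]
    obtain p where "p \<in> K" "\<And>y. y \<in> K \<Longrightarrow> fst p \<le> fst y" by blast
    moreover from this(1) have "0 < fst p" using K(2) affine_group_iff by blast
    ultimately show ?thesis by blast
  qed (auto intro: exI[of _ 1])
  then show "K \<in> sets affine_haar" "emeasure affine_haar K < \<infinity>"
    using emeasure_affine_haar_finite[of K] K(1) by (auto simp: compact_imp_bounded compact_imp_closed borel_closed)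
qed

text \<open>Properness makes the closure of a ball around the identity compact, and compactness for
  the metric is compactness in the usual topology. The metric is thereby traded for compact sets,
  which have finite Haar measure.\<close>

lemma eventually_at_infinity_wrtD:
  assumes D: "proper_left_invariant_metric D" and ev: "eventually P (at_infinity_wrt D)"
  obtains K where "compact K" "K \<subseteq> affine_group" "\<And>p. p \<in> affine_group - K \<Longrightarrow> P p"
proof -
  interpret Metric_space affine_group D
    using D by (simp add: proper_left_invariant_metric_def)
  have "(1, 0) \<in> affine_group" by (simp add: affine_group_iff)
  obtain R where R: "\<And>p. p \<in> affine_group \<Longrightarrow> R \<le> D p (1, 0) \<Longrightarrow> P p"
    using ev by (auto simp: at_infinity_wrt_def eventually_inf_principal eventually_filtercomap eventually_at_top_linorder)
  define K where "K = mtopology closure_of mball (1, 0) R"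
  have "compactin (top_of_set affine_group) K"
    using D \<open>(1, 0) \<in> affine_group\<close> unfolding proper_left_invariant_metric_def K_def by metis
  then have "compact K" "K \<subseteq> affine_group" by (auto simp: compactin_subtopology)
  moreover have "P p" if "p \<in> affine_group - K" for p
  proof (rule R)
    have "mball (1, 0) R \<subseteq> K" unfolding K_def by (rule closure_of_subset) auto
    then show "R \<le> D p (1, 0)"
      using that \<open>(1, 0) \<in> affine_group\<close> by (force simp: in_mball commute)
  qed (use that in simp)
  ultimately show ?thesis by (rule that)
qed

section \<open>Wavelets\<close>

lemma rep_wavelet_AE:
  fixes \<phi> :: "'a::euclidean_space L2"
  assumes "a \<noteq> 0"
  shows "AE x in lborel. rep_L2 (wavelet \<phi> (a, b)) x
    = complex_of_real (a powr (- real DIM('a) / 2)) * rep_L2 \<phi> (x /\<^sub>R a - b)"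
  unfolding wavelet_def using assms
  by (simp add: rep_abs_L2_AE square_integrable_cmult square_integrable_dilate square_integrable_rep_L2)

lemma integral_lborel_dilate:
  fixes G :: "'a::euclidean_space \<Rightarrow> complex"
  assumes a: "0 < a" and G [measurable]: "G \<in> borel_measurable borel"
  shows "(LINT x|lborel. G (x /\<^sub>R a - b)) = of_real (a ^ DIM('a)) * (LINT x|lborel. G x)"
proof -
  have *: "(lborel :: 'a measure)
      = density (distr lborel borel (\<lambda>x. - b + inverse a *\<^sub>R x)) (\<lambda>_. ennreal (inverse a ^ DIM('a)))"
    using lborel_affine[of "inverse a" "- b"] a by simp
  have "(LINT x|lborel. G x) = (LINT x|lborel. (inverse a ^ DIM('a)) *\<^sub>R G (- b + inverse a *\<^sub>R x))"
    using a by (subst *) (simp add: integral_density integral_distr)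
  also have "\<dots> = of_real (inverse a ^ DIM('a)) * (LINT x|lborel. G (x /\<^sub>R a - b))"
    by (simp add: scaleR_conv_of_real)
  finally show ?thesis using a by (simp add: field_simps)
qed

lemma cinner_wavelet:
  fixes \<phi> :: "'a::euclidean_space L2"
  assumes "a \<noteq> 0"
  shows "cinner f (wavelet \<phi> (a, b)) = (LINT x|lborel. rep_L2 f x *
    cnj (complex_of_real (a powr (- real DIM('a) / 2)) * rep_L2 \<phi> (x /\<^sub>R a - b)))"
  unfolding cinner_rep using rep_wavelet_AE[OF assms, of \<phi> b] by (intro integral_cong_AE) auto

lemma cinner_wavelet_wavelet:
  fixes \<phi> \<psi> :: "'a::euclidean_space L2"
  assumes "a \<noteq> 0" "a' \<noteq> 0"
  shows "cinner (wavelet \<psi> (a', b')) (wavelet \<phi> (a, b)) = (LINT x|lborel.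
    complex_of_real (a' powr (- real DIM('a) / 2)) * rep_L2 \<psi> (x /\<^sub>R a' - b') *
    cnj (complex_of_real (a powr (- real DIM('a) / 2)) * rep_L2 \<phi> (x /\<^sub>R a - b)))"
  unfolding cinner_wavelet[OF assms(1)]
proof (rule integral_cong_AE)
  show "AE x in lborel. rep_L2 (wavelet \<psi> (a', b')) x *
      cnj (complex_of_real (a powr (- real DIM('a) / 2)) * rep_L2 \<phi> (x /\<^sub>R a - b)) =
    complex_of_real (a' powr (- real DIM('a) / 2)) * rep_L2 \<psi> (x /\<^sub>R a' - b') *
      cnj (complex_of_real (a powr (- real DIM('a) / 2)) * rep_L2 \<phi> (x /\<^sub>R a - b))"
    using rep_wavelet_AE[OF assms(2), of \<psi> b'] by eventually_elim simp
qed measurable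

text \<open>The wavelets form an orbit of a unitary representation of the group. Substituting
  \<open>x /\<^sub>R a - b\<close> removes \<open>p\<close> from both arguments, and the two factors
  \<open>a powr (- real DIM('a) / 2)\<close> cancel the Jacobian.\<close>

lemma cinner_wavelet_covariant:
  fixes \<phi> \<psi> :: "'a::euclidean_space L2"
  assumes p: "p \<in> affine_group" and q: "q \<in> affine_group"
  shows "cinner (wavelet \<psi> p) (wavelet \<phi> (affine_mult p q)) = cinner \<psi> (wavelet \<phi> q)"
proof -
  obtain a b a' b' where pq: "p = (a, b)" "q = (a', b')" by (metis surj_pair)
  have a: "0 < a" "0 < a'" using p q by (auto simp: pq affine_group_iff)
  let ?s = "- real DIM('a) / 2"
  define G where "G y = rep_L2 \<psi> y * cnj (complex_of_real (a' powr ?s) * rep_L2 \<phi> (y /\<^sub>R a' - b'))" for y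
  have [measurable]: "G \<in> borel_measurable borel" unfolding G_def by measurable
  have arg: "x /\<^sub>R (a * a') - (b /\<^sub>R a' + b') = (x /\<^sub>R a - b) /\<^sub>R a' - b'" for x :: 'a
    by (simp add: scaleR_diff_right mult.commute)
  have "a powr ?s * a powr ?s = a powr (- real DIM('a))" by (simp add: powr_add[symmetric])
  also have "\<dots> = inverse (a ^ DIM('a))" using a by (simp add: powr_minus powr_realpow)
  finally have pw: "complex_of_real (a powr ?s) * complex_of_real (a powr ?s)
      = of_real (inverse (a ^ DIM('a)))"
    by (simp only: of_real_mult[symmetric])
  have "cinner (wavelet \<psi> p) (wavelet \<phi> (affine_mult p q)) = (LINT x|lborel.
      complex_of_real (a powr ?s) * rep_L2 \<psi> (x /\<^sub>R a - b) *
      cnj (complex_of_real ((a * a') powr ?s) * rep_L2 \<phi> (x /\<^sub>R (a * a') - (b /\<^sub>R a' + b'))))"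
    using a by (simp add: pq affine_mult_def cinner_wavelet_wavelet)
  also have "\<dots> = (LINT x|lborel. of_real (inverse (a ^ DIM('a))) * G (x /\<^sub>R a - b))"
    unfolding arg pw[symmetric] G_def using a by (simp add: powr_mult mult_ac)
  also have "\<dots> = of_real (inverse (a ^ DIM('a))) * (LINT x|lborel. G (x /\<^sub>R a - b))"
    by simp
  also have "\<dots> = (LINT x|lborel. G x)"
    using a by (simp add: integral_lborel_dilate)
  also have "\<dots> = cinner \<psi> (wavelet \<phi> q)"
    using a by (simp add: pq cinner_wavelet G_def)
  finally show ?thesis .
qed

lemma norm_wavelet:
  assumes "p \<in> affine_group"
  shows "norm (wavelet \<phi> p) = norm \<phi>"
proof -
  have "(1, 0) \<in> affine_group" by (simp add: affine_group_iff)
  from cinner_wavelet_covariant[OF assms this, of \<phi> \<phi>]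
  have "cinner (wavelet \<phi> p) (wavelet \<phi> p) = cinner \<phi> (wavelet \<phi> (1, 0))"
    by (simp add: affine_mult_one)
  also have "\<dots> = cinner \<phi> \<phi>" by (simp add: cinner_wavelet) (simp add: cinner_rep)
  finally have "(norm (wavelet \<phi> p))\<^sup>2 = (norm \<phi>)\<^sup>2"
    by (simp only: cinner_self of_real_eq_iff)
  then show ?thesis by simp
qed

text \<open>\<open>rep_L2\<close> picks a representative for every wavelet separately, which says
  nothing about joint measurability in \<open>p\<close> and \<open>x\<close>. The explicit integrand
  is jointly measurable, and on the group its integral is the inner product.\<close>

lemma measurable_cinner_wavelet:
  fixes f \<phi> :: "'a::euclidean_space L2"
  shows "(\<lambda>p. cinner f (wavelet \<phi> p)) \<in> borel_measurable affine_haar"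
proof (rule measurable_cong[THEN iffD1])
  show "(\<lambda>p. LINT x|lborel. rep_L2 f x *
      cnj (complex_of_real (fst p powr (- real DIM('a) / 2)) * rep_L2 \<phi> (x /\<^sub>R fst p - snd p)))
    \<in> borel_measurable affine_haar"
    by (rule measurable_affine_haarI) (unfold borel_prod[symmetric], measurable)
qed (auto simp: affine_group_iff cinner_wavelet)

lemma measurable_cinner_wavelet_wavelet:
  fixes \<phi> \<psi> :: "'a::euclidean_space L2"
  shows "(\<lambda>(p, q). cinner (wavelet \<psi> p) (wavelet \<phi> q)) \<in> borel_measurable (affine_haar \<Otimes>\<^sub>M affine_haar)"
proof (rule measurable_cong[THEN iffD1])
  show "(\<lambda>z. LINT x|lborel.
      complex_of_real (fst (fst z) powr (- real DIM('a) / 2)) * rep_L2 \<psi> (x /\<^sub>R fst (fst z) - snd (fst z)) *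
      cnj (complex_of_real (fst (snd z) powr (- real DIM('a) / 2)) * rep_L2 \<phi> (x /\<^sub>R fst (snd z) - snd (snd z))))
    \<in> borel_measurable (affine_haar \<Otimes>\<^sub>M affine_haar)"
  proof -
    have [measurable]: "(\<lambda>z. fst z) \<in> measurable (affine_haar \<Otimes>\<^sub>M affine_haar) (borel \<Otimes>\<^sub>M borel)"
      "(\<lambda>z. snd z) \<in> measurable (affine_haar \<Otimes>\<^sub>M affine_haar) (borel \<Otimes>\<^sub>M borel)"
      using measurable_compose[OF measurable_fst measurable_affine_haar_ident]
        measurable_compose[OF measurable_snd measurable_affine_haar_ident]
      by (simp_all add: borel_prod)
    show ?thesis by measurable
  qed
qed (auto simp: affine_group_iff cinner_wavelet_wavelet space_pair_measure)

section \<open>The scale weight and the Schur condition for wavelets\<close>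

lemma measurable_scale_weight [measurable]: "scale_weight \<epsilon> \<in> borel_measurable affine_haar"
  by (rule measurable_affine_haarI) (unfold borel_prod[symmetric] scale_weight_def, measurable)

lemma scale_weight_pos: "p \<in> affine_group \<Longrightarrow> 0 < scale_weight \<epsilon> p"
  by (simp add: scale_weight_def affine_group_iff)

lemma scale_weight_mult:
  "p \<in> affine_group \<Longrightarrow> q \<in> affine_group \<Longrightarrow>
    scale_weight \<epsilon> (affine_mult p q) = scale_weight \<epsilon> p * scale_weight \<epsilon> q"
  by (simp add: scale_weight_def affine_mult_def affine_group_iff powr_mult)

lemma wavelet_schur_constant:
  fixes \<phi> :: "'a::euclidean_space L2"
  assumes "\<phi> \<in> B1 (scale_weight \<epsilon>)"
  shows "(\<integral>\<^sup>+q. ennreal (cmod (cinner \<phi> (wavelet \<phi> q)) * scale_weight \<epsilon> q) \<partial>affine_haar) < \<infinity>"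
proof -
  note [measurable] = measurable_cinner_wavelet
  have "(\<integral>\<^sup>+q. ennreal (cmod (wavelet_transform \<phi> \<phi> q)) \<partial>density affine_haar (\<lambda>p. ennreal (scale_weight \<epsilon> p))) < \<infinity>"
    using assms by (simp add: B1_def integrable_iff_bounded)
  also have "(\<integral>\<^sup>+q. ennreal (cmod (wavelet_transform \<phi> \<phi> q)) \<partial>density affine_haar (\<lambda>p. ennreal (scale_weight \<epsilon> p)))
      = (\<integral>\<^sup>+q. ennreal (scale_weight \<epsilon> q) * ennreal (cmod (wavelet_transform \<phi> \<phi> q)) \<partial>affine_haar)"
    by (rule nn_integral_density) (simp_all add: wavelet_transform_def[abs_def])
  also have "\<dots> = (\<integral>\<^sup>+q. ennreal (cmod (cinner \<phi> (wavelet \<phi> q)) * scale_weight \<epsilon> q) \<partial>affine_haar)"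
    by (intro nn_integral_cong) (simp add: wavelet_transform_def ennreal_mult'' scale_weight_def mult.commute)
  finally show ?thesis .
qed

text \<open>Left invariance moves the point \<open>p\<close> to the identity, at the price of a
  factor \<open>scale_weight \<epsilon> p\<close> on the weight. The function \<open>F\<close> is
  general because the kernel is translated both in the Schur integral and in its truncation near
  infinity.\<close>

lemma wavelet_kernel_translate:
  fixes \<phi> :: "'a::euclidean_space L2" and F :: "real \<Rightarrow> real \<Rightarrow> ennreal"
  assumes p: "p \<in> affine_group"
    and F: "(\<lambda>q. F (cmod (cinner (wavelet \<phi> p) (wavelet \<phi> q))) (scale_weight \<epsilon> q)) \<in> borel_measurable affine_haar"
  shows "(\<integral>\<^sup>+q. F (cmod (cinner (wavelet \<phi> p) (wavelet \<phi> q))) (scale_weight \<epsilon> q) \<partial>affine_haar)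
    = (\<integral>\<^sup>+q. F (cmod (cinner \<phi> (wavelet \<phi> q))) (scale_weight \<epsilon> p * scale_weight \<epsilon> q) \<partial>affine_haar)"
  unfolding nn_integral_affine_haar_left_invariant[OF F p, symmetric]
  by (intro nn_integral_cong) (simp add: p cinner_wavelet_covariant scale_weight_mult)

lemma wavelet_schur_family:
  fixes \<phi> :: "'a::euclidean_space L2"
  assumes "\<phi> \<in> B1 (scale_weight \<epsilon>)"
  obtains C where "schur_family affine_haar (wavelet \<phi>) (scale_weight \<epsilon>) (norm \<phi>) C"
proof -
  note [measurable] = measurable_cinner_wavelet
  define I where "I = (\<integral>\<^sup>+q. ennreal (cmod (cinner \<phi> (wavelet \<phi> q)) * scale_weight \<epsilon> q) \<partial>affine_haar)"
  \<comment> \<open>The added 1 makes \<open>C\<close> positive even when the integral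
    vanishes.\<close>
  define C where "C = enn2real I + 1"
  have "I < \<infinity>" unfolding I_def by (rule wavelet_schur_constant[OF assms])
  then have "I = ennreal (enn2real I)" by simp
  also have "\<dots> \<le> ennreal C" unfolding C_def by (intro ennreal_leI) simp
  finally have IC: "I \<le> ennreal C" .
  have C: "0 < C" unfolding C_def by (simp add: add_nonneg_pos)
  have "schur_family affine_haar (wavelet \<phi>) (scale_weight \<epsilon>) (norm \<phi>) C"
  proof (intro schur_family.intro sigma_finite_affine_haar schur_family_axioms.intro)
    fix p :: "real \<times> 'a" assume "p \<in> space affine_haar"
    then have p: "p \<in> affine_group" by simp
    have w: "0 < scale_weight \<epsilon> p" by (rule scale_weight_pos[OF p])
    show "0 < scale_weight \<epsilon> p" by (rule w)
    show "norm (wavelet \<phi> p) \<le> norm \<phi>" by (simp add: norm_wavelet[OF p])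
    have "(\<integral>\<^sup>+q. ennreal (cmod (cinner (wavelet \<phi> p) (wavelet \<phi> q)) * scale_weight \<epsilon> q) \<partial>affine_haar)
        = (\<integral>\<^sup>+q. ennreal (cmod (cinner \<phi> (wavelet \<phi> q)) * (scale_weight \<epsilon> p * scale_weight \<epsilon> q)) \<partial>affine_haar)"
      by (rule wavelet_kernel_translate[OF p, where F = "\<lambda>k w. ennreal (k * w)"]) measurable
    also have "\<dots> = (\<integral>\<^sup>+q. ennreal (scale_weight \<epsilon> p)
        * ennreal (cmod (cinner \<phi> (wavelet \<phi> q)) * scale_weight \<epsilon> q) \<partial>affine_haar)"
      using w by (intro nn_integral_cong) (simp add: ennreal_mult'[symmetric] mult_ac)
    also have "\<dots> = ennreal (scale_weight \<epsilon> p) * I"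
      unfolding I_def by (rule nn_integral_cmult) measurable
    also have "\<dots> \<le> ennreal (scale_weight \<epsilon> p) * ennreal C" by (intro mult_left_mono IC) simp
    finally show "(\<integral>\<^sup>+q. ennreal (cmod (cinner (wavelet \<phi> p) (wavelet \<phi> q))
        * scale_weight \<epsilon> q) \<partial>affine_haar)
        \<le> ennreal (C * scale_weight \<epsilon> p)"
      using w C by (simp add: ennreal_mult mult.commute)
  qed (use C measurable_cinner_wavelet_wavelet in \<open>auto\<close>)
  then show ?thesis by (rule that)
qed

text \<open>Dominated convergence: where \<open>k\<close> is positive the condition fails for all
  large \<open>n\<close>, and where \<open>k\<close> is 0 so is the integrand.\<close>

lemma nn_integral_large_ratio_tendsto_0:
  fixes k w :: "'p \<Rightarrow> real"
  assumes [measurable]: "k \<in> borel_measurable M" "w \<in> borel_measurable M"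
    and nonneg: "\<And>x. x \<in> space M \<Longrightarrow> 0 \<le> k x"
    and fin: "(\<integral>\<^sup>+x. ennreal (k x * w x) \<partial>M) < \<infinity>"
  shows "(\<lambda>n. \<integral>\<^sup>+x. ennreal (if real n * k x < w x then k x * w x else 0) \<partial>M) \<longlonglongrightarrow> 0"
proof -
  have "(\<lambda>n. \<integral>\<^sup>+x. ennreal (if real n * k x < w x then k x * w x else 0) \<partial>M) \<longlonglongrightarrow> (\<integral>\<^sup>+x. 0 \<partial>M)"
  proof (rule nn_integral_dominated_convergence[where w = "\<lambda>x. ennreal (k x * w x)"])
    show "AE x in M. (\<lambda>n. ennreal (if real n * k x < w x then k x * w x else 0)) \<longlonglongrightarrow> 0"
    proof (rule AE_I2)
      fix x assume x: "x \<in> space M"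
      show "(\<lambda>n. ennreal (if real n * k x < w x then k x * w x else 0)) \<longlonglongrightarrow> 0"
      proof (cases "k x = 0")
        case False
        then have k: "0 < k x" using nonneg[OF x] by simp
        obtain N where N: "w x / k x < real N" using reals_Archimedean2 by blast
        have "\<not> real n * k x < w x" if "N \<le> n" for n
        proof -
          have "w x / k x < real n" using N that by simp
          then show ?thesis using k by (simp add: field_simps)
        qed
        then show ?thesis
          by (intro tendsto_eventually eventually_sequentiallyI[of N]) auto
      qed simp
    qed
  qed (use fin in auto)
  then show ?thesis by simp
qed

text \<open>The kernel is split where the weight dominates a large multiple of it: there its weighted
  integral is small, elsewhere the kernel is controlled by its square, to which thinness applies.\<close>

lemma thin_row_integrals_small:
  fixes \<phi> :: "'a::euclidean_space L2"
  assumes D: "proper_left_invariant_metric D"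
    and \<phi>: "\<phi> \<in> B1 (scale_weight \<epsilon>)"
    and \<sigma> [measurable]: "\<sigma> \<in> borel_measurable affine_haar"
    and bound: "AE p in affine_haar. \<bar>\<sigma> p\<bar> \<le> s" and s: "0 < s"
    and nonneg: "AE p in affine_haar. 0 \<le> \<sigma> p"
    and thin: "thin D \<phi> \<sigma>" and \<delta>: "0 < \<delta>"
  shows "\<exists>K\<in>sets affine_haar. emeasure affine_haar K < \<infinity> \<and> (\<forall>p\<in>space affine_haar - K.
    (\<integral>\<^sup>+q. ennreal (\<bar>\<sigma> q\<bar> * cmod (cinner (wavelet \<phi> p) (wavelet \<phi> q)) * scale_weight \<epsilon> q) \<partial>affine_haar)
      \<le> ennreal (\<delta> * scale_weight \<epsilon> p))"
proof -
  note [measurable] = measurable_cinner_wavelet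
  let ?k = "\<lambda>q. cmod (cinner \<phi> (wavelet \<phi> q))" and ?w = "scale_weight \<epsilon> :: real \<times> 'a \<Rightarrow> real"
  let ?K = "\<lambda>p q. cmod (cinner (wavelet \<phi> p) (wavelet \<phi> q))"
  let ?T = "\<lambda>n. \<integral>\<^sup>+q. ennreal (if real n * ?k q < ?w q then ?k q * ?w q else 0) \<partial>affine_haar"
  have "?T \<longlonglongrightarrow> 0"
    by (rule nn_integral_large_ratio_tendsto_0) (use wavelet_schur_constant[OF \<phi>] in auto)
  \<comment> \<open>Each part of the split kernel is allotted half of
    \<open>\<delta> * scale_weight \<epsilon> p\<close>; the divisors \<open>s\<close> here and
    \<open>n\<close> below anticipate the factors that the two parts acquire.\<close>
  moreover have "0 < ennreal (\<delta> / (2 * s))" using \<delta> s by simp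
  ultimately have "eventually (\<lambda>n. ?T n < ennreal (\<delta> / (2 * s)) \<and> 0 < n) sequentially"
    by (intro eventually_conj order_tendstoD(2) eventually_gt_at_top) auto
  then obtain n where n: "?T n \<le> ennreal (\<delta> / (2 * s))" "0 < real n"
    by (auto simp: eventually_sequentially intro: less_imp_le)
  have "0 < ennreal (\<delta> / (2 * n))" using \<delta> n(2) by simp
  then have "eventually (\<lambda>p. (\<integral>\<^sup>+q. ennreal (\<sigma> q * (?K q p)\<^sup>2) \<partial>affine_haar) < ennreal (\<delta> / (2
      * n))) (at_infinity_wrt D)"
    using thin unfolding thin_def by (rule order_tendstoD(2)[rotated])
  then obtain K where K: "compact K" "K \<subseteq> affine_group"
    "\<And>p. p \<in> affine_group - K \<Longrightarrow> (\<integral>\<^sup>+q. ennreal (\<sigma> q * (?K q p)\<^sup>2) \<partial>affine_haar) < ennreal (\<delta> / (2 * n))"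
    using eventually_at_infinity_wrtD[OF D] by blast
  have "(\<integral>\<^sup>+q. ennreal (\<bar>\<sigma> q\<bar> * ?K p q * ?w q) \<partial>affine_haar) \<le> ennreal (\<delta> * ?w p)"
    if p: "p \<in> affine_group - K" for p
  proof -
    have p': "p \<in> affine_group" using p by simp
    have w: "0 < ?w p" by (rule scale_weight_pos[OF p'])
    \<comment> \<open>The threshold contains \<open>?w p\<close> because translation multiplies
      \<open>?w q\<close> by it as well; after cancellation the condition is that of
      \<open>?T n\<close>, which does not depend on \<open>p\<close>.\<close>
    define F where "F k y = ennreal (if real n * (?w p * k) < y then k * y else 0)" for k y
    have "(\<integral>\<^sup>+q. ennreal (\<bar>\<sigma> q\<bar> * ?K p q * ?w q) \<partial>affine_haar)
        \<le> (\<integral>\<^sup>+q. ennreal (n * ?w p) * ennreal (\<sigma> q * (?K q p)\<^sup>2) + ennreal s * F (?K p q) (?w q) \<partial>affine_haar)"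
    proof (rule nn_integral_mono_AE)
      show "AE q in affine_haar. ennreal (\<bar>\<sigma> q\<bar> * ?K p q * ?w q)
          \<le> ennreal (n * ?w p) * ennreal (\<sigma> q * (?K q p)\<^sup>2) + ennreal s * F (?K p q) (?w q)"
        using bound nonneg AE_space
      proof eventually_elim
        case (elim q)
        have wq: "0 < ?w q" using elim(3) by (simp add: scale_weight_pos)
        have sym: "?K q p = ?K p q" by (subst cinner_commute) simp
        show ?case
        proof (cases "real n * (?w p * ?K p q) < ?w q")
          case True
          have "\<bar>\<sigma> q\<bar> * (?K p q * ?w q) \<le> s * (?K p q * ?w q)"
            using elim(1) wq by (intro mult_right_mono) auto
          then have "ennreal (\<bar>\<sigma> q\<bar> * ?K p q * ?w q) \<le> ennreal s * F (?K p q) (?w q)"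
            using True s by (simp add: F_def ennreal_mult'[symmetric] ennreal_leI mult.assoc)
          then show ?thesis by (rule order_trans) (simp add: le_add_same_cancel2)
        next
          case False
          \<comment> \<open>The weight at \<open>q\<close> is exchanged for \<open>n * ?w p\<close>
            times a second copy of the kernel, which produces the square in the definition of
            \<open>thin\<close>.\<close>
          have "\<sigma> q * ?K p q * ?w q \<le> \<sigma> q * ?K p q * (real n * (?w p * ?K p q))"
            using False elim(2) by (intro mult_left_mono) auto
          also have "\<dots> = n * ?w p * (\<sigma> q * (?K q p)\<^sup>2)"
            by (simp add: sym power2_eq_square)
          finally have "ennreal (\<bar>\<sigma> q\<bar> * ?K p q * ?w q)
              \<le> ennreal (n * ?w p) * ennreal (\<sigma> q * (?K q p)\<^sup>2)"
            using elim(2) w by (simp add: ennreal_mult'[symmetric] ennreal_leI)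
          then show ?thesis by (rule order_trans) (simp add: le_add_same_cancel1)
        qed
      qed
    qed
    also have "\<dots> = ennreal (n * ?w p) * (\<integral>\<^sup>+q. ennreal (\<sigma> q * (?K q p)\<^sup>2) \<partial>affine_haar)
        + ennreal s * (\<integral>\<^sup>+q. F (?K p q) (?w q) \<partial>affine_haar)"
    proof -
      have [measurable]: "(\<lambda>q. cinner (wavelet \<phi> q) (wavelet \<phi> p)) \<in> borel_measurable affine_haar"
        by (subst cinner_commute) measurable
      show ?thesis unfolding F_def by (simp add: nn_integral_add nn_integral_cmult)
    qed
    also have "(\<integral>\<^sup>+q. F (?K p q) (?w q) \<partial>affine_haar) = (\<integral>\<^sup>+q. F (?k q) (?w p * ?w q) \<partial>affine_haar)"
      by (rule wavelet_kernel_translate[OF p']) (unfold F_def, measurable)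
    also have "\<dots> = (\<integral>\<^sup>+q. ennreal (?w p)
        * ennreal (if real n * ?k q < ?w q then ?k q * ?w q else 0) \<partial>affine_haar)"
    proof (rule nn_integral_cong)
      fix q
      have "real n * (?w p * ?k q) < ?w p * ?w q \<longleftrightarrow> real n * ?k q < ?w q"
        using w mult_less_cancel_left_pos[OF w, of "real n * ?k q" "?w q"] by (simp add: mult_ac)
      then show "F (?k q) (?w p * ?w q)
          = ennreal (?w p) * ennreal (if real n * ?k q < ?w q then ?k q * ?w q else 0)"
        using w by (simp add: F_def ennreal_mult'[symmetric] mult_ac)
    qed
    also have "\<dots> = ennreal (?w p) * ?T n"
      by (rule nn_integral_cmult) measurable
    also have "ennreal (n * ?w p) * (\<integral>\<^sup>+q. ennreal (\<sigma> q * (?K q p)\<^sup>2) \<partial>affine_haar) + ennreal s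
        * (ennreal (?w p) * ?T n)
        \<le> ennreal (n * ?w p) * ennreal (\<delta> / (2 * n)) + ennreal s * (ennreal (?w p) * ennreal (\<delta> / (2 * s)))"
      by (intro add_mono mult_left_mono n(1) less_imp_le[OF K(3)[OF p]]) auto
    also have "\<dots> = ennreal (\<delta> * ?w p)"
      using w \<delta> s n(2) by (simp add: ennreal_mult[symmetric] ennreal_plus[symmetric] del: ennreal_plus)
    finally show ?thesis .
  qed
  with emeasure_affine_haar_compact[OF K(1,2)] show ?thesis by auto
qed

theorem theorem6:
  fixes D :: "real \<times> 'a::euclidean_space \<Rightarrow> real \<times> 'a \<Rightarrow> real"
    and \<phi> :: "'a L2"
    and \<sigma> :: "real \<times> 'a \<Rightarrow> real"
  assumes "proper_left_invariant_metric D"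
    and "\<phi> \<in> A1"
    and "\<sigma> \<in> Linfty"
    and "AE p in affine_haar. 0 \<le> \<sigma> p"
    and "thin D \<phi> \<sigma>"
  shows "compact_operator (localization_operator \<phi> \<sigma>)"
proof -
  obtain \<epsilon> where \<epsilon>: "\<phi> \<in> B1 (scale_weight \<epsilon>)" using assms(2) by (auto simp: A1_def)
  obtain C where "schur_family affine_haar (wavelet \<phi>) (scale_weight \<epsilon>) (norm \<phi>) C"
    by (rule wavelet_schur_family[OF \<epsilon>])
  then interpret schur_family affine_haar "wavelet \<phi>" "scale_weight \<epsilon>" "norm \<phi>" C .
  obtain B where \<sigma>: "\<sigma> \<in> borel_measurable affine_haar" and B: "AE p in affine_haar. \<bar>\<sigma> p\<bar> \<le> B"
    using assms(3) by (auto simp: Linfty_def)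
  \<comment> \<open>The maximum with 1 makes the bound positive, as \<open>symbol_bounded\<close>
    demands.\<close>
  define s where "s = max B 1"
  have bound: "AE p in affine_haar. \<bar>\<sigma> p\<bar> \<le> s"
    using B by eventually_elim (simp add: s_def)
  have s: "0 < s" by (simp add: s_def)
  have "compact_operator (loc_op \<sigma>)"
  proof (rule compact_operator_loc_op)
    show "symbol_bounded \<sigma> s" using \<sigma> bound s by (simp add: symbol_bounded_def)
  qed (rule thin_row_integrals_small[OF assms(1) \<epsilon> \<sigma> bound s assms(4,5)])
  \<comment> \<open>Both sides are definite descriptions by the same weak integral and agree by
    unfolding.\<close>
  moreover have "loc_op \<sigma> = localization_operator \<phi> \<sigma>"
    by (intro ext) (simp add: loc_op_def localization_operator_def wavelet_transform_def)
  ultimately show ?thesis by simp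
qed

end
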